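(* Fix $0<\gamma<\frac{1}{2}$. There exists $\alpha>0$ such that for all sufficiently large $n$, if $w$ is chosen uniformly at random from $S_n$, then \[\mathbb{P}\big(\mathsf{EG}(w)\geq 2^{\alpha n}\big)\geq 1-\frac{1}{n^{2\gamma}}.\]
   Context: A reduced word for $w\in S_n$ is a sequence $(i_1,\dots,i_\ell)$ with $w=s_{i_1}\cdots s_{i_\ell}$, $s_i=(i,i+1)$, and $\ell=\ell(w)$ the number of inversions of $w$. For a partition $\lambda$, $a_{w,\lambda}$ is the number of fillings of the Young diagram of $\lambda$ by positive integers, strictly increasing along rows and down columns, such that reading the entries along columns, top to bottom, columns taken from right to left, gives a reduced word for $w$. The Edelman–Greene statistic is $\mathsf{EG}(w)=\sum_\lambda a_{w,\lambda}$. *)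

theory Defs
  imports "HOL-Probability.Probability" "HOL-Combinatorics.Combinatorics"
begin

text \<open>Elements of the symmetric group are functions \<^term>\<open>w :: nat \<Rightarrow> nat\<close> with
  \<^prop>\<open>w permutes {1..n}\<close>; multiplication is composition of functions.\<close>

definition num_inversions :: "nat \<Rightarrow> (nat \<Rightarrow> nat) \<Rightarrow> nat" where
  "num_inversions n w = card {(i, j). i \<in> {1..n} \<and> j \<in> {1..n} \<and> i < j \<and> w i > w j}"

definition word_prod :: "nat list \<Rightarrow> nat \<Rightarrow> nat" where
  "word_prod js = foldr (\<lambda>i v. Transposition.transpose i (i + 1) \<circ> v) js id"

definition reduced_word :: "nat \<Rightarrow> (nat \<Rightarrow> nat) \<Rightarrow> nat list \<Rightarrow> bool" where
  "reduced_word n w js \<longleftrightarrow>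
     (\<forall>i \<in> set js. 1 \<le> i \<and> i < n) \<and> w = word_prod js \<and> length js = num_inversions n w"

text \<open>A partition is the list of its parts, each positive, in weakly decreasing order.\<close>

definition is_partition :: "nat list \<Rightarrow> bool" where
  "is_partition lam \<longleftrightarrow> sorted_wrt (\<ge>) lam \<and> (\<forall>k \<in> set lam. k > 0)"

text \<open>Cells are pairs (row, column), both counted from 0; rows go downwards.\<close>

definition young_diagram :: "nat list \<Rightarrow> (nat \<times> nat) set" where
  "young_diagram lam = {(r, c). r < length lam \<and> c < lam ! r}"

text \<open>The value outside the diagram is pinned down by \<^const>\<open>extensional\<close>, so that distinct
  functions are distinct fillings.\<close>

definition increasing_filling :: "nat list \<Rightarrow> (nat \<times> nat \<Rightarrow> nat) \<Rightarrow> bool" where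
  "increasing_filling lam T \<longleftrightarrow>
     T \<in> extensional (young_diagram lam) \<and>
     (\<forall>x \<in> young_diagram lam. T x > 0) \<and>
     (\<forall>r c c'. (r, c) \<in> young_diagram lam \<and> (r, c') \<in> young_diagram lam \<and> c < c'
        \<longrightarrow> T (r, c) < T (r, c')) \<and>
     (\<forall>r r' c. (r, c) \<in> young_diagram lam \<and> (r', c) \<in> young_diagram lam \<and> r < r'
        \<longrightarrow> T (r, c) < T (r', c))"

definition num_columns :: "nat list \<Rightarrow> nat" where
  "num_columns lam = (case lam of [] \<Rightarrow> 0 | k # _ \<Rightarrow> k)"

definition column_cells :: "nat list \<Rightarrow> nat \<Rightarrow> (nat \<times> nat) list" where
  "column_cells lam c = map (\<lambda>r. (r, c)) (filter (\<lambda>r. c < lam ! r) [0..<length lam])"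

definition reading_order :: "nat list \<Rightarrow> (nat \<times> nat) list" where
  "reading_order lam = concat (map (column_cells lam) (rev [0..<num_columns lam]))"

definition reading_word :: "nat list \<Rightarrow> (nat \<times> nat \<Rightarrow> nat) \<Rightarrow> nat list" where
  "reading_word lam T = map T (reading_order lam)"

definition EG_fillings :: "nat \<Rightarrow> (nat \<Rightarrow> nat) \<Rightarrow> nat list \<Rightarrow> (nat \<times> nat \<Rightarrow> nat) set" where
  "EG_fillings n w lam = {T. increasing_filling lam T \<and> reduced_word n w (reading_word lam T)}"

definition EG_coeff :: "nat \<Rightarrow> (nat \<Rightarrow> nat) \<Rightarrow> nat list \<Rightarrow> nat" where
  "EG_coeff n w lam = card (EG_fillings n w lam)"

text \<open>The sum over all partitions has infinite index set (for which \<^const>\<open>sum\<close> is 0), but only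
  partitions of the number of inversions of \<^term>\<open>w\<close> contribute; see \<open>EG_coeff_eq_0\<close> below.\<close>

definition EG :: "nat \<Rightarrow> (nat \<Rightarrow> nat) \<Rightarrow> nat" where
  "EG n w = (\<Sum>lam | is_partition lam \<and> sum_list lam = num_inversions n w. EG_coeff n w lam)"

lemma young_diagram_Sigma: "young_diagram lam = (SIGMA r:{..<length lam}. {..<lam ! r})"
  by (auto simp: young_diagram_def)

lemma finite_young_diagram: "finite (young_diagram lam)"
  by (simp add: young_diagram_Sigma)

lemma card_young_diagram: "card (young_diagram lam) = sum_list lam"
  by (simp add: young_diagram_Sigma sum_list_sum_nth atLeast0LessThan)

lemma nth_le_num_columns:
  assumes "is_partition lam" "r < length lam"
  shows "lam ! r \<le> num_columns lam"
  using assms by (cases lam) (auto simp: is_partition_def num_columns_def nth_Cons split: nat.splits)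

lemma set_reading_order:
  assumes "is_partition lam"
  shows "set (reading_order lam) = young_diagram lam"
  using nth_le_num_columns[OF assms]
  by (fastforce simp: reading_order_def column_cells_def young_diagram_def)

lemma distinct_reading_order: "distinct (reading_order lam)"
proof -
  have "distinct (concat (map (column_cells lam) (rev [0..<m])))" for m
    by (induction m) (auto simp: column_cells_def distinct_map inj_on_def)
  then show ?thesis
    by (simp add: reading_order_def)
qed

lemma length_reading_word:
  assumes "is_partition lam"
  shows "length (reading_word lam T) = sum_list lam"
  using distinct_card[OF distinct_reading_order[of lam]] set_reading_order[OF assms]
  by (simp add: reading_word_def card_young_diagram)

lemma finite_EG_fillings:
  assumes "is_partition lam"
  shows "finite (EG_fillings n w lam)"
proof (rule finite_subset)
  show "EG_fillings n w lam \<subseteq> (\<Pi>\<^sub>E x \<in> young_diagram lam. {1..<n})"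
    using set_reading_order[OF assms]
    by (auto simp: EG_fillings_def increasing_filling_def reduced_word_def reading_word_def
        PiE_def)
  show "finite (\<Pi>\<^sub>E x \<in> young_diagram lam. {1..<n})"
    by (intro finite_PiE finite_young_diagram) simp
qed

lemma EG_coeff_eq_0:
  assumes "is_partition lam" "sum_list lam \<noteq> num_inversions n w"
  shows "EG_coeff n w lam = 0"
proof -
  have "EG_fillings n w lam = {}"
    using assms length_reading_word[OF assms(1)] by (auto simp: EG_fillings_def reduced_word_def)
  then show ?thesis
    by (simp add: EG_coeff_def)
qed

lemma finite_partitions: "finite {lam. is_partition lam \<and> sum_list lam = k}"
proof (rule finite_subset)
  have "length lam \<le> sum_list lam" if "\<forall>k \<in> set lam. k > 0" for lam :: "nat list"
    using that by (induction lam) auto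
  then show "{lam. is_partition lam \<and> sum_list lam = k} \<subseteq>
      {lam. set lam \<subseteq> {0..k} \<and> length lam \<le> k}"
    by (auto simp: is_partition_def dest: member_le_sum_list)
  show "finite {lam. set lam \<subseteq> {0..k} \<and> length lam \<le> k}"
    by (rule finite_lists_length_le) simp
qed

end

(* The row reading word of the transpose of a filling is the reading word of the statement, so EG(w)
   is at least the number of Edelman-Greene tableaux of w, written here by rows. Suppose w has the
   consecutive pattern 2143 at the positions i, ..., i + 3, and let u be obtained from w by sorting
   these four positions. Given a tableau of u, inserting i, i + 2 or i + 2, i in Edelman-Greene
   fashion yields two tableaux of w. Because u has no descents at i, i + 1, i + 2, the order of
   insertion can be read off the result, and it survives later insertions of larger letters. Hence a
   permutation with k disjoint occurrences of the consecutive pattern has at least 2^k tableaux. In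
   a random permutation the blocks {4k+1, ..., 4k+4} carry the pattern independently with
   probability 1/24, and Chebyshev's inequality finishes the proof. *)
theory Submission
  imports Defs "HOL-Real_Asymp.Real_Asymp"
begin

subsection \<open>Reduced words and inversions\<close>

text \<open>Since s_i and s_(i+2) commute, both orders of insertion lead to the same permutation w =
  u s_i s_(i+2). The difficulty is to show that the two tableaux differ and can still be told apart
  after further insertions. A decoding function does this: it looks only at the letters i + 2 and i
  + 3 of the top row and, while these do not decide, at the letters shifted by one in the next row.
  That u has no descents at i, i + 1, i + 2 means that each of these letters extends a reduced word
  of u to a longer reduced word; so if the top row contains one of them, it also contains its
  successor. Hence either it contains i + 1, i + 2, i + 3, and both orders change it in the same
  way, or it lacks both i and i + 1, and it decides. The constants: the 4! = 24 orders of a block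
  give the mean (n div 4) / 24, half of which serves as threshold; with n div 4 >= n / 8 this yields
  \<alpha> = 1 / (48 * 8) = 1 / 384. Chebyshev leaves the failure probability 768 / n, which is
  eventually below n^(-2\<gamma>) because 2\<gamma> < 1.\<close>

lemma word_prod_Nil [simp]: "word_prod [] = id"
  and word_prod_Cons: "word_prod (x # js) = Transposition.transpose x (x + 1) \<circ> word_prod js"
  by (simp_all add: word_prod_def)

lemma word_prod_append: "word_prod (js @ ks) = word_prod js \<circ> word_prod ks"
  by (induction js) (simp_all add: word_prod_Cons comp_assoc)

lemma word_prod_snoc: "word_prod (js @ [x]) = word_prod js \<circ> Transposition.transpose x (x + 1)"
  by (simp add: word_prod_append word_prod_Cons)

lemma word_prod_commute:
  assumes "\<forall>y \<in> set ys. y + 1 < x \<or> x + 1 < y"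
  shows "word_prod (ys @ [x]) = word_prod (x # ys)"
  using assms
proof (induction ys)
  case (Cons y ys)
  have "Transposition.transpose y (y + 1) \<circ> Transposition.transpose x (x + 1) =
      Transposition.transpose x (x + 1) \<circ> Transposition.transpose y (y + 1)"
    using Cons.prems by (auto simp: fun_eq_iff Transposition.transpose_def)
  then have "word_prod (y # x # ys) = word_prod (x # y # ys)"
    unfolding word_prod_Cons comp_assoc[symmetric] by (rule arg_cong)
  moreover have "word_prod ((y # ys) @ [x]) = word_prod (y # x # ys)"
    using Cons by (simp add: word_prod_Cons[of y])
  ultimately show ?case by simp
qed simp

lemma word_prod_braid: "word_prod [x, x + 1, x] = word_prod [x + 1, x, x + 1]"
  by (auto simp: word_prod_Cons fun_eq_iff Transposition.transpose_def)

lemma word_prod_square: "word_prod [x, x] = id"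
  by (auto simp: word_prod_Cons fun_eq_iff Transposition.transpose_def)

text \<open>Minimal length among all words, without reference to n or to inversions. In this form
  the property passes to infixes and depends only on product and length, which suits local moves on
  words; \<open>reduced_iff\<close> connects it with inversions.\<close>

definition is_reduced :: "nat list \<Rightarrow> bool" where
  "is_reduced js \<longleftrightarrow> (\<forall>ks. word_prod ks = word_prod js \<longrightarrow> length js \<le> length ks)"

lemma reduced_cong:
  assumes "word_prod ks = word_prod js" "length ks = length js"
  shows "is_reduced ks \<longleftrightarrow> is_reduced js"
  using assms by (simp add: is_reduced_def)

lemma reduced_infix:
  assumes "is_reduced (as @ bs @ cs)"
  shows "is_reduced bs"
  unfolding is_reduced_def
proof (intro allI impI)
  fix ks assume "word_prod ks = word_prod bs"
  then have "word_prod (as @ ks @ cs) = word_prod (as @ bs @ cs)"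
    by (simp add: word_prod_append)
  then have "length (as @ bs @ cs) \<le> length (as @ ks @ cs)"
    using assms unfolding is_reduced_def by blast
  then show "length bs \<le> length ks" by simp
qed

lemma reduced_prefix: "is_reduced (as @ bs) \<Longrightarrow> is_reduced as"
  using reduced_infix[of "[]" as bs] by simp

lemma reduced_suffix: "is_reduced (as @ bs) \<Longrightarrow> is_reduced bs"
  using reduced_infix[of as bs "[]"] by simp

section \<open>Inversions and the length of reduced words\<close>

definition inversions :: "(nat \<Rightarrow> nat) \<Rightarrow> (nat \<times> nat) set" where
  "inversions w = {(i, j). i < j \<and> w j < w i}"

lemma inversions_id [simp]: "inversions id = {}" "inversions (\<lambda>x. x) = {}"
  by (auto simp: inversions_def)

text \<open>An adjacent transposition keeps the order of every pair of positions except the pair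
  that it swaps.\<close>

lemma inversions_transpose:
  assumes "x = y + 1" "(i, j) \<in> inversions (w \<circ> Transposition.transpose y x)" "(i, j) \<noteq> (y, x)"
  shows "(Transposition.transpose y x i, Transposition.transpose y x j) \<in> inversions w"
  using assms by (auto simp: inversions_def Transposition.transpose_def split: if_splits)

lemma inversions_transpose_subset:
  "inversions (w \<circ> Transposition.transpose x (x + 1)) \<subseteq>
    insert (x, x + 1) (map_prod (Transposition.transpose x (x + 1)) (Transposition.transpose x (x + 1)) ` inversions w)"
    (is "?L \<subseteq> insert _ (?f ` _)")
proof
  fix p assume p: "p \<in> ?L"
  have "p = ?f (?f p)" by (cases p) simp
  moreover have "?f p \<in> inversions w" if "p \<noteq> (x, x + 1)"
    using inversions_transpose[of "x + 1" x "fst p" "snd p" w] p that by (cases p) auto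
  ultimately show "p \<in> insert (x, x + 1) (?f ` inversions w)" by blast
qed

lemma card_inversions_word_prod:
  "finite (inversions (word_prod js)) \<and> card (inversions (word_prod js)) \<le> length js"
proof (induction js rule: rev_induct)
  case Nil
  show ?case by simp
next
  case (snoc x js)
  let ?f = "map_prod (Transposition.transpose x (x + 1)) (Transposition.transpose x (x + 1))"
  have sub: "inversions (word_prod (js @ [x])) \<subseteq> insert (x, x + 1) (?f ` inversions (word_prod js))"
    unfolding word_prod_snoc by (rule inversions_transpose_subset)
  have fin: "finite (inversions (word_prod js))" using snoc by simp
  have "card (inversions (word_prod (js @ [x]))) \<le> card (insert (x, x + 1) (?f ` inversions (word_prod js)))"
    using sub fin by (intro card_mono) auto
  also have "\<dots> \<le> Suc (card (?f ` inversions (word_prod js)))"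
    using fin by (simp add: card_insert_if)
  also have "\<dots> \<le> Suc (card (inversions (word_prod js)))"
    using card_image_le[OF fin] by simp
  finally show ?case using snoc sub fin by (auto intro: finite_subset)
qed

text \<open>Away from the swapped pair the transposition carries inversions to inversions; the
  descent itself is the inversion of w that is not reached.\<close>

lemma card_inversions_descent:
  assumes "w (x + 1) < w x" "finite (inversions w)"
  shows "card (inversions (w \<circ> Transposition.transpose x (x + 1))) < card (inversions w)"
proof -
  let ?t = "Transposition.transpose x (x + 1)"
  have "map_prod ?t ?t ` inversions (w \<circ> ?t) \<subseteq> inversions w - {(x, x + 1)}"
  proof
    fix p assume "p \<in> map_prod ?t ?t ` inversions (w \<circ> ?t)"
    then obtain i j where ij: "(i, j) \<in> inversions (w \<circ> ?t)" "p = (?t i, ?t j)" by auto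
    have "(i, j) \<noteq> (x, x + 1)" using ij(1) assms(1) by (auto simp: inversions_def)
    then have "p \<in> inversions w" using inversions_transpose[OF refl ij(1)] ij(2) by simp
    moreover have "p \<noteq> (x, x + 1)"
    proof
      assume "p = (x, x + 1)"
      then have "i = x + 1" "j = x"
        using ij(2) by (auto simp: Transposition.transpose_def split: if_splits)
      then show False using ij(1) by (simp add: inversions_def)
    qed
    ultimately show "p \<in> inversions w - {(x, x + 1)}" by simp
  qed
  then have "card (map_prod ?t ?t ` inversions (w \<circ> ?t)) \<le> card (inversions w - {(x, x + 1)})"
    using assms by (intro card_mono) auto
  also have "\<dots> < card (inversions w)"
    using assms by (intro psubset_card_mono) (auto simp: inversions_def)
  also have "card (map_prod ?t ?t ` inversions (w \<circ> ?t)) = card (inversions (w \<circ> ?t))"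
    by (intro card_image inj_on_subset[OF prod.inj_map]) auto
  finally show ?thesis .
qed

lemma inversions_permutes:
  assumes "w permutes {1..n}"
  shows "inversions w = {(i, j). i \<in> {1..n} \<and> j \<in> {1..n} \<and> i < j \<and> w i > w j}"
proof -
  have "i \<in> {1..n} \<and> j \<in> {1..n}" if "i < j" "w j < w i" for i j
    using that permutes_not_in[OF assms, of i] permutes_not_in[OF assms, of j]
      permutes_in_image[OF assms, of i] permutes_in_image[OF assms, of j]
    by (cases "i \<in> {1..n}"; cases "j \<in> {1..n}") auto
  then show ?thesis by (auto simp: inversions_def)
qed

lemma card_inversions:
  "w permutes {1..n} \<Longrightarrow> card (inversions w) = num_inversions n w"
  by (simp add: inversions_permutes num_inversions_def)

lemma finite_inversions:
  assumes "w permutes {1..n}" shows "finite (inversions w)"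
  by (rule finite_subset[of _ "{1..n} \<times> {1..n}"]) (auto simp: inversions_permutes[OF assms])

text \<open>The fixed points outside {1..n} extend monotonicity to all of the naturals, and a
  strictly increasing surjection of the naturals is the identity.\<close>

lemma permutes_without_descent:
  fixes w :: "nat \<Rightarrow> nat"
  assumes w: "w permutes {1..n}" "\<And>x. 1 \<le> x \<Longrightarrow> x < n \<Longrightarrow> w x \<le> w (x + 1)"
  shows "w = id"
proof -
  have le: "w x \<le> w (Suc x)" for x
  proof (cases "1 \<le> x \<and> x < n")
    case True
    then show ?thesis using w(2)[of x] by simp
  next
    case False
    then have "w (Suc x) = Suc x \<or> x = 0"
      using permutes_not_in[OF w(1), of "Suc x"] by auto
    moreover have "w 0 = 0" by (rule permutes_not_in[OF w(1)]) simp
    moreover have "w x \<le> x" if "x \<ge> n"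
    proof (cases "x = n \<and> n \<ge> 1")
      case True
      then have "w x \<in> {1..n}" unfolding permutes_in_image[OF w(1)] by simp
      then show ?thesis using True by simp
    next
      case False
      then have "w x = x" using that by (intro permutes_not_in[OF w(1)]) auto
      then show ?thesis by simp
    qed
    ultimately show ?thesis using False by (cases "x = 0") auto
  qed
  have "w x < w (Suc x)" for x
  proof -
    have "w x \<noteq> w (Suc x)"
      using injD[OF permutes_inj[OF w(1)], of x "Suc x"] by (metis n_not_Suc_n)
    then show ?thesis using le[of x] by simp
  qed
  then have mono: "strict_mono w" by (simp add: strict_mono_Suc_iff)
  have "w x = x" for x
  proof (induction x rule: less_induct)
    case (less x)
    \<comment> \<open>By induction everything below x is fixed, so the preimage y of x is at least
      x; monotonicity then squeezes \<open>w x\<close> between x and \<open>w y = x\<close>.\<close>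
    obtain y where y: "w y = x" using permutes_surj[OF w(1)] by (metis surjD)
    have "x \<le> w x" using mono by (rule strict_mono_imp_increasing)
    moreover have "y \<ge> x" using less[of y] y by (metis not_le nat_less_le)
    then have "w x \<le> w y" using mono by (simp add: strict_mono_less_eq)
    ultimately show ?case using y by simp
  qed
  then show ?thesis by (simp add: fun_eq_iff)
qed

text \<open>Bubble sort: descents are removed one at a time, and each removal contributes the last
  letter of the word.\<close>

lemma ex_word_of_length_inversions:
  assumes "w permutes {1..n}"
  shows "\<exists>js. set js \<subseteq> {1..<n} \<and> word_prod js = w \<and> length js = card (inversions w)"
  using assms
proof (induction "card (inversions w)" arbitrary: w rule: less_induct)
  case less
  show ?case
  proof (cases "\<exists>x. 1 \<le> x \<and> x < n \<and> w (x + 1) < w x")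
    case True
    then obtain x where x: "1 \<le> x" "x < n" "w (x + 1) < w x" by blast
    let ?t = "Transposition.transpose x (x + 1)"
    have perm: "w \<circ> ?t permutes {1..n}"
      using x less.prems by (intro permutes_compose permutes_swap_id) auto
    have lt: "card (inversions (w \<circ> ?t)) < card (inversions w)"
      using x less.prems by (intro card_inversions_descent finite_inversions)
    obtain js where js: "set js \<subseteq> {1..<n}" "word_prod js = w \<circ> ?t"
        "length js = card (inversions (w \<circ> ?t))"
      using less.hyps[OF lt perm] by blast
    have "word_prod (js @ [x]) = w"
      unfolding word_prod_snoc js(2) comp_assoc by simp
    \<comment> \<open>Removing a descent is only known to lower the number of inversions by at least
      one; this bound shows that it is exactly one.\<close>
    moreover from this have "card (inversions w) \<le> length (js @ [x])"
      using card_inversions_word_prod[of "js @ [x]"] by simp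
    ultimately show ?thesis
      using js x lt by (intro exI[of _ "js @ [x]"]) auto
  next
    case False
    then have "w = id" using permutes_without_descent[OF less.prems] by (meson not_le)
    then show ?thesis by (intro exI[of _ "[]"]) simp
  qed
qed

lemma reduced_iff:
  assumes "word_prod js permutes {1..n}"
  shows "is_reduced js \<longleftrightarrow> length js = num_inversions n (word_prod js)"
proof -
  obtain ks where "word_prod ks = word_prod js" "length ks = num_inversions n (word_prod js)"
    using ex_word_of_length_inversions[OF assms] card_inversions[OF assms] by auto
  moreover have "num_inversions n (word_prod js) \<le> length ks" if "word_prod ks = word_prod js" for ks
    using card_inversions_word_prod[of ks] that card_inversions[OF assms] by simp
  ultimately show ?thesis
    unfolding is_reduced_def by (metis le_antisym)
qed

lemma reduced_snoc:
  assumes "word_prod js permutes {1..n}" "is_reduced js" "1 \<le> x" "x < n"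
    and "word_prod js x < word_prod js (x + 1)"
  shows "is_reduced (js @ [x])"
proof -
  let ?t = "Transposition.transpose x (x + 1)" and ?v = "word_prod (js @ [x])"
  have perm: "?v permutes {1..n}"
    unfolding word_prod_snoc using assms(1,3,4) by (intro permutes_compose permutes_swap_id) auto
  have "card (inversions (?v \<circ> ?t)) < card (inversions ?v)"
    using assms(5) by (intro card_inversions_descent finite_inversions[OF perm]) (simp add: word_prod_snoc)
  moreover have "?v \<circ> ?t = word_prod js"
    unfolding word_prod_snoc comp_assoc by simp
  ultimately have "length js < num_inversions n ?v"
    using assms(1,2) perm reduced_iff by (simp add: card_inversions)
  moreover have "num_inversions n ?v \<le> length (js @ [x])"
    using card_inversions_word_prod[of "js @ [x]"] card_inversions[OF perm] by simp
  ultimately show ?thesis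
    using reduced_iff[OF perm] by simp
qed

subsection \<open>Edelman-Greene insertion\<close>

abbreviation row_word :: "nat set \<Rightarrow> nat list" where
  "row_word R \<equiv> sorted_list_of_set R"

text \<open>Rows are strictly increasing, so a set determines a row. The head of the list is the top
  row and is read last, so that a letter appended to the word meets the top row first.\<close>

definition rows_word :: "nat set list \<Rightarrow> nat list" where
  "rows_word S = concat (map row_word (rev S))"

lemma rows_word_Nil [simp]: "rows_word [] = []"
  and rows_word_Cons [simp]: "rows_word (R # S) = rows_word S @ row_word R"
  by (simp_all add: rows_word_def)

text \<open>Schensted bumping, except that a letter already present leaves the row as it is. For
  reduced words x + 1 is then present too (\<open>Suc_mem_of_reduced\<close>), and
  \<open>tab_insert\<close> passes it on to the next row: the special rule of Edelman and
  Greene.\<close>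

definition row_insert :: "nat \<Rightarrow> nat set \<Rightarrow> nat set" where
  "row_insert x R = (if x \<in> R then R
     else if \<exists>y\<in>R. x < y then insert x (R - {Min {y \<in> R. x < y}}) else insert x R)"

fun tab_insert :: "nat \<Rightarrow> nat set list \<Rightarrow> nat set list" where
  "tab_insert x [] = [{x}]"
| "tab_insert x (R # S) =
     row_insert x R # (if \<exists>y\<in>R. x < y then tab_insert (Min {y \<in> R. x < y}) S else S)"

lemma Min_greater:
  fixes x :: nat
  assumes "finite R" "\<exists>y\<in>R. x < y"
  shows "Min {y \<in> R. x < y} \<in> R" "x < Min {y \<in> R. x < y}"
    and "\<And>y. y \<in> R \<Longrightarrow> x < y \<Longrightarrow> Min {y \<in> R. x < y} \<le> y"
proof -
  have "Min {y \<in> R. x < y} \<in> {y \<in> R. x < y}" using assms by (intro Min_in) auto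
  then show "Min {y \<in> R. x < y} \<in> R" "x < Min {y \<in> R. x < y}" by auto
  show "Min {y \<in> R. x < y} \<le> y" if "y \<in> R" "x < y" for y
    using assms that by (intro Min_le) auto
qed

lemma Min_greater_eq:
  fixes x :: nat
  assumes "finite R" "b \<in> R" "x < b" "\<And>y. y \<in> R \<Longrightarrow> x < y \<Longrightarrow> b \<le> y"
  shows "Min {y \<in> R. x < y} = b"
  using assms by (intro Min_eqI) auto

lemma finite_row_insert [simp]: "finite R \<Longrightarrow> finite (row_insert x R)"
  by (simp add: row_insert_def)

lemma row_insert_self [simp]: "x \<in> row_insert x R"
  by (simp add: row_insert_def)

lemma sorted_list_of_set_union:
  fixes A B :: "'a :: linorder set"
  assumes "finite A" "finite B" "\<And>a b. a \<in> A \<Longrightarrow> b \<in> B \<Longrightarrow> a < b"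
  shows "sorted_list_of_set (A \<union> B) = sorted_list_of_set A @ sorted_list_of_set B"
proof (rule sorted_distinct_set_unique)
  show "sorted (sorted_list_of_set A @ sorted_list_of_set B)"
    using assms by (auto simp: sorted_append intro: less_imp_le)
  show "List.distinct (sorted_list_of_set A @ sorted_list_of_set B)"
    using assms by fastforce
qed (use assms in auto)

lemma row_word_split:
  assumes "finite R" "b \<in> R"
  shows "row_word R = row_word {r \<in> R. r < b} @ b # row_word {r \<in> R. b < r}"
proof -
  have "R = {r \<in> R. r < b} \<union> ({b} \<union> {r \<in> R. b < r})" using assms(2) by auto
  also have "row_word \<dots> = row_word {r \<in> R. r < b} @ row_word ({b} \<union> {r \<in> R. b < r})"
    using assms(1) by (intro sorted_list_of_set_union) auto
  also have "row_word ({b} \<union> {r \<in> R. b < r}) = [b] @ row_word {r \<in> R. b < r}"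
    using assms(1) by (subst sorted_list_of_set_union) auto
  finally show ?thesis by simp
qed

lemma not_reduced_square: "\<not> is_reduced (as @ [x, x] @ bs)"
proof
  assume "is_reduced (as @ [x, x] @ bs)"
  then have "is_reduced [x, x]" by (rule reduced_infix)
  moreover have "word_prod [] = word_prod [x, x]" by (simp only: word_prod_square word_prod_Nil)
  ultimately have "length [x, x] \<le> length ([] :: nat list)" unfolding is_reduced_def by blast
  then show False by simp
qed

text \<open>Without x + 1 in the row, the appended x would commute to the left past all larger
  letters until it meets its own copy, and a word containing x x is not reduced.\<close>

lemma Suc_mem_of_reduced:
  assumes "finite R" "x \<in> R" "is_reduced (row_word R @ [x])"
  shows "x + 1 \<in> R"
proof (rule ccontr)
  assume "x + 1 \<notin> R"
  let ?A = "row_word {r \<in> R. r < x}" and ?B = "row_word {r \<in> R. x < r}"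
  have "word_prod (?B @ [x]) = word_prod (x # ?B)"
  proof (intro word_prod_commute ballI disjI2)
    fix y assume "y \<in> set ?B"
    then have "x < y" "y \<noteq> x + 1" using assms(1) \<open>x + 1 \<notin> R\<close> by auto
    then show "x + 1 < y" by simp
  qed
  then have "word_prod (?A @ [x, x] @ ?B) = word_prod (row_word R @ [x])"
    by (simp add: row_word_split[OF assms(1,2)] word_prod_append word_prod_Cons comp_assoc)
  then have "is_reduced (?A @ [x, x] @ ?B)"
    using reduced_cong[of "?A @ [x, x] @ ?B" "row_word R @ [x]"] assms(3)
    by (simp add: row_word_split[OF assms(1,2)])
  then show False using not_reduced_square by blast
qed

text \<open>If \<open>x\<close> bumps \<open>b\<close>, then \<open>x\<close> commutes with the entries to the right of \<open>b\<close> and \<open>b\<close> with those to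
  the left of \<open>x\<close>; if \<open>x\<close> is present, then \<open>b = x + 1\<close> and a braid move is needed.\<close>

lemma row_insert_bump:
  assumes "finite R" "is_reduced (row_word R @ [x])" "\<exists>y\<in>R. x < y"
  defines "b \<equiv> Min {y \<in> R. x < y}"
  shows "word_prod (b # row_word (row_insert x R)) = word_prod (row_word R @ [x])"
    and "card (row_insert x R) = card R"
proof -
  have b: "b \<in> R" "x < b" "\<And>y. y \<in> R \<Longrightarrow> x < y \<Longrightarrow> b \<le> y"
    using Min_greater[OF assms(1,3)] by (auto simp: b_def)
  let ?B = "row_word {r \<in> R. b < r}" and ?A = "row_word {r \<in> R. r < x}"
  have commB: "word_prod (?B @ [x]) = word_prod (x # ?B)"
    using b(2) assms(1) by (intro word_prod_commute) auto
  have commA: "word_prod (?A @ [b]) = word_prod (b # ?A)"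
    using b(2) assms(1) by (intro word_prod_commute) auto
  show "word_prod (b # row_word (row_insert x R)) = word_prod (row_word R @ [x])"
  proof (cases "x \<in> R")
    case True
    then have "x + 1 \<in> R" using Suc_mem_of_reduced assms(1,2) by blast
    then have bx: "b = x + 1" using b(2) b(3)[of "x + 1"] by simp
    have "{r \<in> {r \<in> R. r < b}. r < x} = {r \<in> R. r < x}" "{r \<in> {r \<in> R. r < b}. x < r} = {}"
      using bx by auto
    then have "row_word {r \<in> R. r < b} = ?A @ [x]"
      using row_word_split[of "{r \<in> R. r < b}" x] assms(1) True bx by simp
    then have R: "row_word R = ?A @ [x, b] @ ?B"
      using row_word_split[OF assms(1) b(1)] by simp
    have "word_prod (row_word R @ [x]) = word_prod ?A \<circ> word_prod [x, b] \<circ> word_prod (?B @ [x])"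
      by (simp add: R word_prod_append word_prod_Cons comp_assoc)
    also have "\<dots> = word_prod ?A \<circ> word_prod [x, b, x] \<circ> word_prod ?B"
      unfolding commB by (simp add: word_prod_Cons comp_assoc)
    also have "word_prod [x, b, x] = word_prod [b, x, b]"
      unfolding bx by (rule word_prod_braid)
    also have "word_prod ?A \<circ> word_prod [b, x, b] \<circ> word_prod ?B =
        word_prod (?A @ [b]) \<circ> word_prod [x, b] \<circ> word_prod ?B"
      by (simp add: word_prod_append word_prod_Cons comp_assoc)
    also have "\<dots> = word_prod (b # row_word R)"
      unfolding commA by (simp add: R word_prod_append word_prod_Cons comp_assoc)
    finally show ?thesis using True by (simp add: row_insert_def)
  next
    case False
    have "{r \<in> R. r < b} = {r \<in> R. r < x}"
      using False b by (force simp: not_le[symmetric] nat_less_le)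
    then have R: "row_word R = ?A @ [b] @ ?B"
      using row_word_split[OF assms(1) b(1)] by simp
    have ins: "row_insert x R = insert x (R - {b})"
      using False assms(3) by (simp add: row_insert_def b_def)
    have "{r \<in> insert x (R - {b}). r < x} = {r \<in> R. r < x}"
        "{r \<in> insert x (R - {b}). x < r} = {r \<in> R. b < r}"
      using b by (auto simp: nat_less_le)
    then have R': "row_word (row_insert x R) = ?A @ [x] @ ?B"
      unfolding ins using row_word_split[of "insert x (R - {b})" x] assms(1) by simp
    have "word_prod (row_word R @ [x]) = word_prod (?A @ [b]) \<circ> word_prod (?B @ [x])"
      by (simp add: R word_prod_append word_prod_Cons comp_assoc)
    also have "\<dots> = word_prod (b # row_word (row_insert x R))"
      unfolding commA commB by (simp add: R' word_prod_append word_prod_Cons comp_assoc)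
    finally show ?thesis by simp
  qed
  show "card (row_insert x R) = card R"
    using assms(1,3) b(1) card_Suc_Diff1[OF assms(1) b(1)]
    by (auto simp: row_insert_def b_def[symmetric])
qed

lemma row_insert_append:
  assumes "finite R" "is_reduced (row_word R @ [x])" "\<not> (\<exists>y\<in>R. x < y)"
  shows "row_word (row_insert x R) = row_word R @ [x]" and "x \<notin> R"
proof -
  show x: "x \<notin> R" using Suc_mem_of_reduced[OF assms(1) _ assms(2)] assms(3) by auto
  have "row_insert x R = R \<union> {x}" using x assms(3) by (auto simp: row_insert_def)
  also have "row_word \<dots> = row_word R @ row_word {x}"
    using assms(1,3) x by (intro sorted_list_of_set_union) (auto simp: not_less nat_less_le)
  finally show "row_word (row_insert x R) = row_word R @ [x]" by simp
qed

text \<open>Replacing the row followed by x by b followed by the new row keeps product and length,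
  so \<open>as @ [b]\<close> is a prefix of a reduced word. This supplies the hypothesis for
  inserting b into the rows below.\<close>

lemma reduced_bump:
  assumes "finite R" "is_reduced (as @ row_word R @ [x])" "\<exists>y\<in>R. x < y"
  shows "is_reduced (as @ [Min {y \<in> R. x < y}])"
proof -
  let ?b = "Min {y \<in> R. x < y}"
  have red: "is_reduced (row_word R @ [x])" using assms(2) by (rule reduced_suffix)
  have "word_prod (as @ ?b # row_word (row_insert x R)) = word_prod (as @ row_word R @ [x])"
    unfolding word_prod_append[of as] row_insert_bump(1)[OF assms(1) red assms(3)] ..
  moreover have "length (as @ ?b # row_word (row_insert x R)) = length (as @ row_word R @ [x])"
    using row_insert_bump(2)[OF assms(1) red assms(3)] by simp
  ultimately have "is_reduced ((as @ [?b]) @ row_word (row_insert x R))"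
    using assms(2) reduced_cong[of "as @ ?b # row_word (row_insert x R)"] by simp
  then show ?thesis by (rule reduced_prefix)
qed

lemma tab_insert_word:
  assumes "\<forall>R\<in>set S. finite R" "is_reduced (rows_word S @ [x])"
  shows "word_prod (rows_word (tab_insert x S)) = word_prod (rows_word S @ [x])"
    and "length (rows_word (tab_insert x S)) = length (rows_word S) + 1"
proof -
  have "word_prod (rows_word (tab_insert x S)) = word_prod (rows_word S @ [x]) \<and>
      length (rows_word (tab_insert x S)) = length (rows_word S) + 1"
    using assms
  proof (induction S arbitrary: x)
    case (Cons R S)
    have fin: "finite R" "\<forall>R\<in>set S. finite R" using Cons.prems by auto
    have red: "is_reduced (rows_word S @ row_word R @ [x])" using Cons.prems(2) by simp
    note red' = reduced_suffix[OF red]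
    show ?case
    proof (cases "\<exists>y\<in>R. x < y")
      case True
      let ?b = "Min {y \<in> R. x < y}"
      note IH = Cons.IH[OF fin(2) reduced_bump[OF fin(1) red True]]
      have "word_prod (rows_word (tab_insert x (R # S))) =
          word_prod (rows_word S @ [?b]) \<circ> word_prod (row_word (row_insert x R))"
        using True IH by (simp add: word_prod_append[of "rows_word (tab_insert ?b S)"])
      also have "\<dots> = word_prod (rows_word S) \<circ> word_prod (?b # row_word (row_insert x R))"
        by (simp add: word_prod_append word_prod_Cons comp_assoc)
      also have "\<dots> = word_prod (rows_word (R # S) @ [x])"
        unfolding row_insert_bump(1)[OF fin(1) red' True] by (simp add: word_prod_append comp_assoc)
      finally show ?thesis
        using True IH row_insert_bump(2)[OF fin(1) red' True] by simp
    next
      case False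
      then show ?thesis using row_insert_append[OF fin(1) red' False] by simp
    qed
  qed simp
  then show "word_prod (rows_word (tab_insert x S)) = word_prod (rows_word S @ [x])"
    and "length (rows_word (tab_insert x S)) = length (rows_word S) + 1" by auto
qed

section \<open>Tableaux and their preservation under insertion\<close>

text \<open>Written with counts instead of positions: \<open>R'\<close> is not longer than \<open>R\<close>, and each entry of
  \<open>R'\<close> exceeds the entry of \<open>R\<close> above it.\<close>

definition row_below :: "nat set \<Rightarrow> nat set \<Rightarrow> bool" where
  "row_below R R' \<longleftrightarrow> (\<forall>z. card {r \<in> R'. r \<le> z} \<le> card {r \<in> R. r < z})"

definition tableau :: "nat set list \<Rightarrow> bool" where
  "tableau S \<longleftrightarrow> (\<forall>R\<in>set S. finite R \<and> R \<noteq> {}) \<and> sorted_wrt row_below S"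

lemma row_below_trans:
  assumes "row_below Q R" "row_below R T" "finite R"
  shows "row_below Q T"
  unfolding row_below_def
proof
  fix z
  have "card {r \<in> T. r \<le> z} \<le> card {r \<in> R. r < z}" using assms(2) by (simp add: row_below_def)
  also have "\<dots> \<le> card {r \<in> R. r \<le> z}" using assms(3) by (intro card_mono) auto
  also have "\<dots> \<le> card {r \<in> Q. r < z}" using assms(1) by (simp add: row_below_def)
  finally show "card {r \<in> T. r \<le> z} \<le> card {r \<in> Q. r < z}" .
qed

text \<open>Insertion adds an entry, replaces one by a smaller one, or changes nothing.\<close>

lemma card_row_insert_ge:
  assumes "finite R"
  shows "card {r \<in> R. r < z} \<le> card {r \<in> row_insert x R. r < z}"
proof (cases "x \<notin> R \<and> (\<exists>y\<in>R. x < y)")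
  case True
  let ?b = "Min {y \<in> R. x < y}"
  have b: "?b \<in> R" "x < ?b" using Min_greater[OF assms] True by auto
  have ins: "row_insert x R = insert x (R - {?b})" using True by (simp add: row_insert_def)
  show ?thesis
  proof (cases "?b < z")
    case True': True
    have "{r \<in> row_insert x R. r < z} = insert x ({r \<in> R. r < z} - {?b})"
      unfolding ins using True' b by auto
    moreover have "card (insert x ({r \<in> R. r < z} - {?b})) = card {r \<in> R. r < z}"
      using True True' b(1) assms card_Suc_Diff1[of "{r \<in> R. r < z}" ?b] by simp
    ultimately show ?thesis by simp
  next
    case False
    then show ?thesis unfolding ins using assms by (intro card_mono) auto
  qed
next
  case False
  then show ?thesis using assms by (intro card_mono) (auto simp: row_insert_def)
qed

lemma row_below_row_insert:
  assumes "finite R" "row_below R R'"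
  shows "row_below (row_insert x R) R'"
  using assms(2) card_row_insert_ge[OF assms(1)] unfolding row_below_def by (meson order_trans)

text \<open>The count for \<open>R'\<close> grows only at thresholds z from b up to the next larger
  entry of \<open>R'\<close>. There x, whether newly placed or already present, is the additional
  entry of the upper row below z.\<close>

lemma row_below_bump:
  assumes "finite R" "finite R'" "row_below R R'" "\<exists>y\<in>R. x < y"
    and b_def: "b = Min {y \<in> R. x < y}"
    and xR: "x \<in> R \<Longrightarrow> x + 1 \<in> R" and bR': "b \<in> R' \<Longrightarrow> b + 1 \<in> R'"
  shows "row_below (row_insert x R) (row_insert b R')"
proof (cases "b \<in> R'")
  case True
  then have "row_insert b R' = R'" by (simp add: row_insert_def)
  then show ?thesis using row_below_row_insert assms(1,3) by simp
next
  case False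
  have b: "b \<in> R" "x < b" "\<And>y. y \<in> R \<Longrightarrow> x < y \<Longrightarrow> b \<le> y"
    using Min_greater[OF assms(1,4)] by (auto simp: b_def)
  show ?thesis unfolding row_below_def
  proof
    fix z
    have le: "card {r \<in> R'. r \<le> z} \<le> card {r \<in> row_insert x R. r < z}"
      using row_below_row_insert[OF assms(1,3)] by (simp add: row_below_def)
    show "card {r \<in> row_insert b R'. r \<le> z} \<le> card {r \<in> row_insert x R. r < z}"
    proof (cases "b \<le> z \<and> \<not> (\<exists>e\<in>R'. b < e \<and> e \<le> z)")
      case True
      have sub: "{r \<in> row_insert b R'. r \<le> z} \<subseteq> insert b {r \<in> R'. r \<le> b}"
        using True by (auto simp: row_insert_def split: if_splits)
      have "card {r \<in> row_insert b R'. r \<le> z} \<le> card (insert b {r \<in> R'. r \<le> b})"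
        using sub assms(2) by (intro card_mono) auto
      also have "\<dots> = card {r \<in> R'. r \<le> b} + 1" using False assms(2) by simp
      also have "\<dots> \<le> card {r \<in> row_insert x R. r < z}"
      proof (cases "x \<in> R")
        case xin: True
        have "b = x + 1" using xR[OF xin] b(2) b(3)[of "x + 1"] by simp
        \<comment> \<open>As \<open>b = x + 1\<close> is not in \<open>R'\<close>, the comparison of
          the rows can be made at x instead of b; it then counts entries of R below x only, and x
          itself is left over.\<close>
        have "{r \<in> R'. r \<le> b} = {r \<in> R'. r \<le> x}"
          using False \<open>b = x + 1\<close> by (auto simp: le_Suc_eq)
        then have "card {r \<in> R'. r \<le> b} + 1 \<le> card {r \<in> R. r < x} + 1"
          using assms(3) by (simp add: row_below_def)
        also have "\<dots> = card (insert x {r \<in> R. r < x})" using assms(1) by simp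
        also have "\<dots> \<le> card {r \<in> R. r < z}"
          using True \<open>b = x + 1\<close> xin assms(1) by (intro card_mono) auto
        finally show ?thesis using xin by (simp add: row_insert_def)
      next
        case xout: False
        have ins: "row_insert x R = insert x (R - {b})"
          using xout assms(4) by (simp add: row_insert_def b_def)
        have "card {r \<in> R'. r \<le> b} + 1 \<le> card {r \<in> R. r < b} + 1"
          using assms(3) by (simp add: row_below_def)
        also have "\<dots> = card (insert x {r \<in> R. r < b})" using xout assms(1) by simp
        also have "\<dots> \<le> card {r \<in> row_insert x R. r < z}"
          unfolding ins using True b(2) assms(1) by (intro card_mono) auto
        finally show ?thesis .
      qed
      finally show ?thesis .
    next
      case False': False
      have "card {r \<in> row_insert b R'. r \<le> z} \<le> card {r \<in> R'. r \<le> z}"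
      proof (cases "b \<le> z")
        case True
        then obtain e where e: "e \<in> R'" "b < e" "e \<le> z" using False' by blast
        let ?e = "Min {y \<in> R'. b < y}"
        have ex: "\<exists>y\<in>R'. b < y" using e by blast
        have m: "?e \<in> R'" "?e \<le> z"
          using Min_greater(1)[OF assms(2) ex] Min_greater(3)[OF assms(2) ex e(1,2)] e(3) by auto
        have "{r \<in> row_insert b R'. r \<le> z} = insert b ({r \<in> R'. r \<le> z} - {?e})"
          using False ex True by (auto simp: row_insert_def)
        moreover have "card (insert b ({r \<in> R'. r \<le> z} - {?e})) = card {r \<in> R'. r \<le> z}"
          using False m assms(2) card_Suc_Diff1[of "{r \<in> R'. r \<le> z}" ?e] by simp
        ultimately show ?thesis by simp
      next
        case False
        then show ?thesis using assms(2)
          by (intro card_mono) (auto simp: row_insert_def split: if_splits)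
      qed
      then show ?thesis using le by simp
    qed
  qed
qed

lemma tableau_Cons:
  "tableau (R # S) \<longleftrightarrow> finite R \<and> R \<noteq> {} \<and> tableau S \<and> (S \<noteq> [] \<longrightarrow> row_below R (hd S))"
proof (cases S)
  case (Cons R' S')
  have "row_below R T" if "tableau S" "row_below R R'" "T \<in> set S'" for T
    using that row_below_trans[of R R' T] by (auto simp: Cons tableau_def)
  then show ?thesis by (auto simp: Cons tableau_def)
qed (auto simp: tableau_def)

lemma tableau_tab_insert:
  assumes "tableau S" "is_reduced (rows_word S @ [x])"
  shows "tableau (tab_insert x S)"
  using assms
proof (induction S arbitrary: x)
  case Nil
  show ?case by (simp add: tableau_def)
next
  case (Cons R S)
  have fin: "finite R" and S: "tableau S" and hd: "S \<noteq> [] \<Longrightarrow> row_below R (hd S)"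
    using Cons.prems(1) by (auto simp: tableau_Cons)
  have red: "is_reduced (rows_word S @ row_word R @ [x])" using Cons.prems(2) by simp
  have nonempty: "row_insert x R \<noteq> {}" using row_insert_self[of x R] by blast
  show ?case
  proof (cases "\<exists>y\<in>R. x < y")
    case True
    let ?b = "Min {y \<in> R. x < y}"
    have red_b: "is_reduced (rows_word S @ [?b])" by (rule reduced_bump[OF fin red True])
    have xR: "x + 1 \<in> R" if "x \<in> R"
      using Suc_mem_of_reduced[OF fin that reduced_suffix[OF red]] .
    have "row_below (row_insert x R) (hd (tab_insert ?b S))"
    proof (cases S)
      \<comment> \<open>A missing row is treated as an empty one, so that a letter starting a new
        row is covered by \<open>row_below_bump\<close>.\<close>
      case Nil
      have "Min {y \<in> R. x < y} \<in> R" "x < ?b" using Min_greater[OF fin True] by auto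
      moreover have "row_below R {}" by (simp add: row_below_def)
      moreover have "row_insert ?b {} = {?b}" by (simp add: row_insert_def)
      ultimately show ?thesis
        using row_below_bump[OF fin _ _ True refl xR, of "{}"] Nil by simp
    next
      case (Cons R' S')
      have fin': "finite R'" using S by (simp add: Cons tableau_Cons)
      have "is_reduced (row_word R' @ [?b])"
        using reduced_suffix[of "rows_word S'" "row_word R' @ [?b]"] red_b Cons by simp
      then have "?b + 1 \<in> R'" if "?b \<in> R'" using Suc_mem_of_reduced[OF fin' that] by simp
      then show ?thesis
        using row_below_bump[OF fin fin' _ True refl xR] hd Cons by simp
    qed
    then show ?thesis
      using Cons.IH[OF S red_b] True fin nonempty by (simp add: tableau_Cons)
  next
    case False
    then show ?thesis
      using S fin hd nonempty row_below_row_insert[OF fin] by (simp add: tableau_Cons)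
  qed
qed

lemma set_rows_word:
  "\<forall>R\<in>set S. finite R \<Longrightarrow> set (rows_word S) = \<Union> (set S)"
  by (induction S) auto

lemma Union_tab_insert:
  assumes "\<forall>R\<in>set S. finite R"
  shows "\<Union> (set (tab_insert x S)) \<subseteq> insert x (\<Union> (set S))"
  using assms
proof (induction S arbitrary: x)
  case (Cons R S)
  have "row_insert x R \<subseteq> insert x R" by (auto simp: row_insert_def split: if_splits)
  moreover have "\<Union> (set (tab_insert (Min {y \<in> R. x < y}) S)) \<subseteq> R \<union> \<Union> (set S)" if "\<exists>y\<in>R. x < y"
    using Cons.IH[of "Min {y \<in> R. x < y}"] Min_greater(1)[OF _ that] Cons.prems by auto
  ultimately show ?case using Cons.prems by auto
qed simp

lemma ex_tableau:
  assumes "is_reduced js"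
  shows "\<exists>S. tableau S \<and> set (rows_word S) \<subseteq> set js \<and>
    word_prod (rows_word S) = word_prod js \<and> length (rows_word S) = length js"
  using assms
proof (induction js rule: rev_induct)
  case Nil
  show ?case by (intro exI[of _ "[]"]) (simp add: tableau_def)
next
  case (snoc x js)
  then obtain S where S: "tableau S" "set (rows_word S) \<subseteq> set js"
      "word_prod (rows_word S) = word_prod js" "length (rows_word S) = length js"
    using reduced_prefix by blast
  have fin: "\<forall>R\<in>set S. finite R" using S(1) by (simp add: tableau_def)
  have eq: "word_prod (rows_word S @ [x]) = word_prod (js @ [x])"
    by (simp add: word_prod_append S(3))
  then have red: "is_reduced (rows_word S @ [x])"
    using reduced_cong[OF eq] S(4) snoc.prems by simp
  have tab: "tableau (tab_insert x S)" by (rule tableau_tab_insert[OF S(1) red])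
  moreover have "set (rows_word (tab_insert x S)) \<subseteq> insert x (set (rows_word S))"
    using Union_tab_insert[OF fin] tab by (simp add: set_rows_word fin tableau_def)
  ultimately show ?case
    using tab_insert_word[OF fin red] eq S by (intro exI[of _ "tab_insert x S"]) auto
qed

definition EG_tableau :: "nat \<Rightarrow> (nat \<Rightarrow> nat) \<Rightarrow> nat set list \<Rightarrow> bool" where
  "EG_tableau n w S \<longleftrightarrow> tableau S \<and> reduced_word n w (rows_word S)"

lemma ex_EG_tableau:
  assumes "w permutes {1..n}"
  shows "\<exists>S. EG_tableau n w S"
proof -
  obtain js where js: "set js \<subseteq> {1..<n}" "word_prod js = w" "length js = num_inversions n w"
    using ex_word_of_length_inversions[OF assms] card_inversions[OF assms] by auto
  then have "is_reduced js" using reduced_iff[of js n] assms by simp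
  then obtain S where "tableau S" "set (rows_word S) \<subseteq> set js"
      "word_prod (rows_word S) = w" "length (rows_word S) = length js"
    using ex_tableau js(2) by metis
  then have "EG_tableau n w S"
    using js by (auto simp: EG_tableau_def reduced_word_def)
  then show ?thesis ..
qed

lemma EG_tableau_tab_insert:
  assumes "w permutes {1..n}" "EG_tableau n w S" "1 \<le> x" "x < n" "w x < w (x + 1)"
  shows "is_reduced (rows_word S @ [x])"
    and "EG_tableau n (w \<circ> Transposition.transpose x (x + 1)) (tab_insert x S)"
proof -
  have S: "tableau S" "\<forall>i\<in>set (rows_word S). 1 \<le> i \<and> i < n" "word_prod (rows_word S) = w"
      "length (rows_word S) = num_inversions n w" and fin: "\<forall>R\<in>set S. finite R"
    using assms(2) by (auto simp: EG_tableau_def reduced_word_def tableau_def)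
  have "is_reduced (rows_word S)" using S assms(1) by (simp add: reduced_iff[of _ n])
  then show red: "is_reduced (rows_word S @ [x])"
    using reduced_snoc assms S(3) by simp
  let ?v = "w \<circ> Transposition.transpose x (x + 1)"
  have perm: "?v permutes {1..n}"
    using assms by (intro permutes_compose permutes_swap_id) auto
  have v: "word_prod (rows_word S @ [x]) = ?v" by (simp add: word_prod_snoc S(3))
  have tab: "tableau (tab_insert x S)" by (rule tableau_tab_insert[OF S(1) red])
  have "set (rows_word (tab_insert x S)) \<subseteq> insert x (set (rows_word S))"
    using Union_tab_insert[OF fin] tab by (simp add: set_rows_word fin tableau_def)
  then have "\<forall>i\<in>set (rows_word (tab_insert x S)). 1 \<le> i \<and> i < n" using S(2) assms by auto
  moreover have "length (rows_word (tab_insert x S)) = num_inversions n ?v"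
    using reduced_iff[of "rows_word S @ [x]" n] red perm tab_insert_word(2)[OF fin red]
    by (simp add: v)
  ultimately show "EG_tableau n ?v (tab_insert x S)"
    using tab tab_insert_word(1)[OF fin red] v by (simp add: EG_tableau_def reduced_word_def)
qed

subsection \<open>Recovering the order of insertion\<close>

text \<open>Recovers from a tableau in which order \<open>i\<close> and \<open>i + 2\<close> were inserted. As long as both
  \<open>i + 2\<close> and \<open>i + 3\<close> are in the row, either order has bumped \<open>i + 1\<close> and \<open>i + 3\<close> in the same
  order, and the question passes to the next row with \<open>i\<close> replaced by \<open>i + 1\<close>.\<close>

fun inserted_upwards :: "nat \<Rightarrow> nat set list \<Rightarrow> bool" where
  "inserted_upwards i [] = False"
| "inserted_upwards i (R # S) =
     (if i + 2 \<in> R \<and> i + 3 \<in> R then inserted_upwards (i + 1) S else i + 2 \<in> R)"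

lemma row_insert_Suc_mem:
  assumes "finite R" "x + 1 \<in> R"
  shows "row_insert x R = (if x \<in> R then R else insert x (R - {x + 1}))"
    and "Min {y \<in> R. x < y} = x + 1" "\<exists>y\<in>R. x < y"
proof -
  show Min: "Min {y \<in> R. x < y} = x + 1"
    using assms by (intro Min_greater_eq) auto
  show ex: "\<exists>y\<in>R. x < y" using assms(2) by auto
  show "row_insert x R = (if x \<in> R then R else insert x (R - {x + 1}))"
    using ex by (simp add: row_insert_def Min)
qed

lemma row_insert_not_mem:
  assumes "finite R" "x \<notin> R" "b \<in> R" "x < b" "\<And>y. y \<in> R \<Longrightarrow> x < y \<Longrightarrow> b \<le> y"
  shows "row_insert x R = insert x (R - {b})"
proof -
  have "\<exists>y\<in>R. x < y" using assms by blast
  moreover have "Min {y \<in> R. x < y} = b" using assms by (intro Min_greater_eq)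
  ultimately show ?thesis using assms(2) by (simp add: row_insert_def)
qed

lemma row_insert_subset: "row_insert x R \<subseteq> insert x R"
  by (auto simp: row_insert_def split: if_splits)

text \<open>If i + 3 is present, it is lost: when i + 2 is present too, i bumps i + 2, and the i + 2
  inserted afterwards bumps i + 3; otherwise i bumps i + 3 directly.\<close>

lemma row_insert_upwards:
  assumes "finite R" "i + 3 \<in> R \<Longrightarrow> i + 1 \<notin> R" "i + 2 \<in> R \<Longrightarrow> i + 3 \<in> R"
    and "i \<in> R \<Longrightarrow> i + 1 \<in> R" "i + 1 \<in> R \<Longrightarrow> i + 2 \<in> R"
  shows "i + 3 \<notin> row_insert (i + 2) (row_insert i R)"
proof (cases "i + 3 \<in> R")
  case True
  have i: "i \<notin> R" "i + 1 \<notin> R" using assms True by auto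
  show ?thesis
  proof (cases "i + 2 \<in> R")
    case True': True
    have "row_insert i R = insert i (R - {i + 2})"
      using True' i assms(1) by (intro row_insert_not_mem) (auto simp: Suc_le_eq intro: le_neq_implies_less)
    moreover have "row_insert (i + 2) (insert i (R - {i + 2})) =
        insert (i + 2) (insert i (R - {i + 2}) - {i + 3})"
      using True assms(1) by (intro row_insert_not_mem) auto
    ultimately show ?thesis by simp
  next
    case False
    have "i + 3 \<le> y" if "y \<in> R" "i < y" for y
    proof (rule ccontr)
      assume "\<not> i + 3 \<le> y"
      then have "y = i + 1 \<or> y = i + 2" using that by linarith
      then show False using that i False by auto
    qed
    then have "row_insert i R = insert i (R - {i + 3})"
      using True i assms(1) by (intro row_insert_not_mem) auto
    then show ?thesis using row_insert_subset[of "i + 2" "row_insert i R"] by auto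
  qed
next
  case False
  then have "i + 3 \<notin> insert (i + 2) (insert i R)" by simp
  then show ?thesis
    using row_insert_subset[of "i + 2" "row_insert i R"] row_insert_subset[of i R] by blast
qed

text \<open>With i and i + 1 absent, the smallest entry above i is the i + 2 just inserted, and i
  bumps it.\<close>

lemma row_insert_downwards:
  assumes "finite R" "i \<notin> R" "i + 1 \<notin> R"
  shows "i + 2 \<notin> row_insert i (row_insert (i + 2) R)"
proof -
  let ?R = "row_insert (i + 2) R"
  have i: "i \<notin> ?R" "i + 1 \<notin> ?R" using row_insert_subset[of "i + 2" R] assms(2,3) by auto
  have "i + 2 \<le> y" if "y \<in> ?R" "i < y" for y
  proof (rule ccontr)
    assume "\<not> i + 2 \<le> y"
    then have "y = i + 1" using that by linarith
    then show False using that i by auto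
  qed
  then have "row_insert i ?R = insert i (?R - {i + 2})"
    using i assms(1) by (intro row_insert_not_mem) auto
  then show ?thesis by simp
qed

text \<open>The letter i + 1 is never inserted into S, yet its hypothesis matters: it puts i + 2
  into a top row containing i + 1, and bumping by i, i + 1, i + 2 then yields the three hypotheses
  for i + 1 in the remaining rows, where the letters to be inserted are i + 1 and i + 3.\<close>

lemma inserted_upwards_tab_insert:
  assumes "\<forall>R\<in>set S. finite R"
    and "\<And>j. j \<in> {i, i + 1, i + 2} \<Longrightarrow> is_reduced (rows_word S @ [j])"
  shows "inserted_upwards i (tab_insert (i + 2) (tab_insert i S)) \<and>
    \<not> inserted_upwards i (tab_insert i (tab_insert (i + 2) S))"
  using assms
proof (induction S arbitrary: i)
  case Nil
  have "row_insert (i + 2) {} = {i + 2}" by (simp add: row_insert_def)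
  then have "i + 2 \<notin> row_insert i {i + 2}"
    using row_insert_downwards[of "{}" i] by simp
  moreover have "i + 3 \<notin> row_insert (i + 2) {i}"
    using row_insert_subset[of "i + 2" "{i}"] by auto
  ultimately show ?case by simp
next
  case (Cons R S)
  have fin: "finite R" "\<forall>R\<in>set S. finite R" using Cons.prems(1) by auto
  have red: "is_reduced (rows_word S @ row_word R @ [j])" if "j \<in> {i, i + 1, i + 2}" for j
    using Cons.prems(2)[OF that] by simp
  have up: "j + 1 \<in> R" if "j \<in> {i, i + 1, i + 2}" "j \<in> R" for j
    using Suc_mem_of_reduced[OF fin(1) that(2) reduced_suffix[OF red[OF that(1)]]] .
  have up': "i \<in> R \<Longrightarrow> i + 1 \<in> R" "i + 1 \<in> R \<Longrightarrow> i + 2 \<in> R" "i + 2 \<in> R \<Longrightarrow> i + 3 \<in> R"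
    using up[of i] up[of "i + 1"] up[of "i + 2"] by (auto simp: numeral_3_eq_3)
  show ?case
  proof (cases "i + 1 \<in> R")
    case True
    let ?R = "insert i (R - {i + 1})"
    have mem: "i + 2 \<in> R" "i + 3 \<in> R" using True up' by auto
    have bump: "is_reduced (rows_word S @ [j + 1])" if "j \<in> {i, i + 1, i + 2}" for j
    proof -
      have "j + 1 \<in> R" using that True mem by (auto simp: numeral_3_eq_3)
      note J = row_insert_Suc_mem[OF fin(1) this]
      show ?thesis using reduced_bump[OF fin(1) red[OF that] J(3)] unfolding J(2) .
    qed
    have "is_reduced (rows_word S @ [j])" if "j \<in> {i + 1, i + 1 + 1, i + 1 + 2}" for j
      using that bump[of i] bump[of "i + 1"] bump[of "i + 2"] by (auto simp: numeral_3_eq_3)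
    note IH = Cons.IH[OF fin(2) this]
    \<comment> \<open>The top row after inserting i. Inserting i + 2, before or after, leaves the
      row alone since i + 2 and i + 3 are present, so Q results from both orders.\<close>
    define Q where "Q = (if i \<in> R then R else ?R)"
    have Q: "row_insert i R = Q" "finite Q" "i + 2 \<in> Q" "i + 2 + 1 \<in> Q"
      using row_insert_Suc_mem[OF fin(1) True] fin(1) mem by (auto simp: Q_def numeral_3_eq_3)
    note I = row_insert_Suc_mem[OF fin(1) True]
    note J = row_insert_Suc_mem[OF Q(2) Q(4)]
    have "i + 2 + 1 \<in> R" using mem by (simp add: numeral_3_eq_3)
    note K = row_insert_Suc_mem[OF fin(1) this]
    have "tab_insert (i + 2) (tab_insert i (R # S)) =
        Q # tab_insert (i + 1 + 2) (tab_insert (i + 1) S)"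
      using I(2,3) J Q by simp
    moreover have "tab_insert i (tab_insert (i + 2) (R # S)) =
        Q # tab_insert (i + 1) (tab_insert (i + 1 + 2) S)"
      using I(2,3) K mem(1) Q(1) by simp
    ultimately show ?thesis using IH Q by (simp add: numeral_3_eq_3)
  next
    case False
    then have "i \<notin> R" using up' by blast
    have "i + 3 \<notin> row_insert (i + 2) (row_insert i R)"
      using fin(1) False up' by (intro row_insert_upwards) auto
    moreover have "i + 2 \<notin> row_insert i (row_insert (i + 2) R)"
      using fin(1) False \<open>i \<notin> R\<close> by (intro row_insert_downwards)
    ultimately show ?thesis by simp
  qed
qed

text \<open>Inserting x does not touch entries below x, and the letter it bumps exceeds x; the
  margin of 4 therefore survives when the test moves to the next row with i + 1.\<close>

lemma inserted_upwards_tab_insert_larger: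
  assumes "\<forall>R\<in>set S. finite R" "i + 4 \<le> x"
  shows "inserted_upwards i (tab_insert x S) = inserted_upwards i S"
  using assms
proof (induction S arbitrary: i x)
  case (Cons R S)
  have mem: "z \<in> row_insert x R \<longleftrightarrow> z \<in> R" if "z < x" for z
  proof (cases "\<exists>y\<in>R. x < y")
    case True
    then have "x < Min {y \<in> R. x < y}" using Cons.prems(1) by (intro Min_greater) auto
    then show ?thesis using that by (auto simp: row_insert_def)
  next
    case False
    then show ?thesis using that by (auto simp: row_insert_def)
  qed
  have "inserted_upwards (i + 1) (tab_insert (Min {y \<in> R. x < y}) S) = inserted_upwards (i + 1) S"
    if "\<exists>y\<in>R. x < y"
  proof (rule Cons.IH)
    show "i + 1 + 4 \<le> Min {y \<in> R. x < y}"
      using Min_greater(2)[OF _ that] Cons.prems by simp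
  qed (use Cons.prems in auto)
  then show ?case using mem[of "i + 2"] mem[of "i + 3"] Cons.prems(2) by simp
qed simp

text \<open>Rows are nonempty, so their number is at most the length of the word.\<close>

lemma finite_EG_tableaux: "finite {S. EG_tableau n w S}"
proof (rule finite_subset)
  have "length S \<le> length (rows_word S)" if "\<forall>R\<in>set S. finite R \<and> R \<noteq> {}" for S
    using that
  proof (induction S)
    case (Cons R S)
    then have "card R > 0" by (simp add: card_gt_0_iff)
    then show ?case using Cons by simp
  qed simp
  then show "{S. EG_tableau n w S} \<subseteq> {S. set S \<subseteq> Pow {1..<n} \<and> length S \<le> num_inversions n w}"
    using set_rows_word by (fastforce simp: EG_tableau_def tableau_def reduced_word_def)
  show "finite {S. set S \<subseteq> Pow {1..<n} \<and> length S \<le> num_inversions n w}"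
    by (rule finite_lists_length_le) simp
qed

section \<open>Independent choices at disjoint occurrences of the pattern\<close>

definition has_2143_at :: "(nat \<Rightarrow> nat) \<Rightarrow> nat \<Rightarrow> bool" where
  "has_2143_at w i \<longleftrightarrow> w (i + 1) < w i \<and> w i < w (i + 3) \<and> w (i + 3) < w (i + 2)"

text \<open>Every set A of choices is realised. Positions enter by induction on the largest one, so
  that the two letters inserted last exceed each earlier position by at least 4 and leave the
  earlier choices readable.\<close>

lemma ex_EG_tableau_inserted_upwards:
  assumes "finite K" "w permutes {1..n}" "\<And>k. k \<in> K \<Longrightarrow> 1 \<le> k \<and> k + 3 \<le> n"
    and "\<And>k l. k \<in> K \<Longrightarrow> l \<in> K \<Longrightarrow> k < l \<Longrightarrow> k + 4 \<le> l"
    and "\<And>k. k \<in> K \<Longrightarrow> has_2143_at w k"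
  shows "\<exists>S. EG_tableau n w S \<and> (\<forall>k\<in>K. inserted_upwards k S \<longleftrightarrow> k \<in> A)"
  using assms
proof (induction K arbitrary: w rule: finite_linorder_max_induct)
  case empty
  then show ?case using ex_EG_tableau by auto
next
  case (insert i K)
  let ?t = "\<lambda>x::nat. Transposition.transpose x (x + 1)"
  define u where "u = w \<circ> ?t i \<circ> ?t (i + 2)"
  have i: "1 \<le> i" "i + 3 \<le> n" using insert.prems(2)[of i] by auto
  have u_perm: "u permutes {1..n}"
    unfolding u_def using i insert.prems(1) by (intro permutes_compose permutes_swap_id) auto
  have wi: "w (i + 1) < w i" "w i < w (i + 3)" "w (i + 3) < w (i + 2)"
    using insert.prems(4)[of i] by (auto simp: has_2143_at_def)
  have u: "u i = w (i + 1)" "u (i + 1) = w i" "u (i + 2) = w (i + 3)" "u (i + 3) = w (i + 2)"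
    by (simp_all add: u_def Transposition.transpose_def numeral_3_eq_3)
  have gap: "k + 4 \<le> i" if "k \<in> K" for k
    using insert.prems(3)[of k i] insert.hyps(2) that by auto
  have "\<exists>S. EG_tableau n u S \<and> (\<forall>k\<in>K. inserted_upwards k S \<longleftrightarrow> k \<in> A)"
  proof (rule insert.IH[OF u_perm])
    fix k assume k: "k \<in> K"
    have "u x = w x" if "x < i" for x using that by (simp add: u_def Transposition.transpose_def)
    then show "has_2143_at u k"
      using insert.prems(4)[of k] gap[OF k] k by (simp add: has_2143_at_def)
  qed (use insert.prems in auto)
  then obtain S where S: "EG_tableau n u S" "\<forall>k\<in>K. inserted_upwards k S \<longleftrightarrow> k \<in> A" by blast
  have fin: "\<forall>R\<in>set T. finite R" if "EG_tableau n v T" for v T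
    using that by (simp add: EG_tableau_def tableau_def)
  \<comment> \<open>The ascent of u at i + 1 is the inequality \<open>w i < w (i + 3)\<close>; here
    the pattern 2143 gives more than two descents.\<close>
  have red: "is_reduced (rows_word S @ [j])" if "j \<in> {i, i + 1, i + 2}" for j
  proof (rule EG_tableau_tab_insert(1)[OF u_perm S(1)])
    show "u j < u (j + 1)" using that u wi by (auto simp: numeral_3_eq_3)
  qed (use that i in auto)
  have two: "EG_tableau n (u \<circ> ?t x \<circ> ?t y) (tab_insert y (tab_insert x S)) \<and>
      (\<forall>k\<in>K. inserted_upwards k (tab_insert y (tab_insert x S)) \<longleftrightarrow> k \<in> A)"
    if xy: "(x, y) \<in> {(i, i + 2), (i + 2, i)}" for x y
  proof -
    have range: "1 \<le> x" "x < n" "1 \<le> y" "y < n" "i \<le> x" "i \<le> y" using xy i by auto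
    have x: "EG_tableau n (u \<circ> ?t x) (tab_insert x S)"
    proof (rule EG_tableau_tab_insert(2)[OF u_perm S(1)])
      show "u x < u (x + 1)" using xy u wi by (auto simp: numeral_3_eq_3)
    qed (use range in auto)
    have perm: "u \<circ> ?t x permutes {1..n}"
      using range u_perm by (intro permutes_compose permutes_swap_id) auto
    have y: "EG_tableau n (u \<circ> ?t x \<circ> ?t y) (tab_insert y (tab_insert x S))"
    proof (rule EG_tableau_tab_insert(2)[OF perm x])
      show "(u \<circ> ?t x) y < (u \<circ> ?t x) (y + 1)" using xy u wi by (auto simp: Transposition.transpose_def numeral_3_eq_3)
    qed (use range in auto)
    have "inserted_upwards k (tab_insert y (tab_insert x S)) = inserted_upwards k S" if "k \<in> K" for k
      using gap[OF that] range fin[OF x] fin[OF S(1)] by (simp add: inserted_upwards_tab_insert_larger)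
    then show ?thesis using y S(2) by simp
  qed
  \<comment> \<open>The two transpositions are disjoint, so both orders of insertion end at
    w.\<close>
  have w: "u \<circ> ?t i \<circ> ?t (i + 2) = w" "u \<circ> ?t (i + 2) \<circ> ?t i = w"
    by (auto simp: u_def fun_eq_iff Transposition.transpose_def)
  note up = inserted_upwards_tab_insert[OF fin[OF S(1)], of i, OF red]
  show ?case
  proof (cases "i \<in> A")
    case True
    have "EG_tableau n w (tab_insert (i + 2) (tab_insert i S)) \<and>
        (\<forall>k\<in>K. inserted_upwards k (tab_insert (i + 2) (tab_insert i S)) \<longleftrightarrow> k \<in> A)"
      using two[of i "i + 2"] unfolding w by simp
    then show ?thesis using True up by blast
  next
    case False
    have "EG_tableau n w (tab_insert i (tab_insert (i + 2) S)) \<and>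
        (\<forall>k\<in>K. inserted_upwards k (tab_insert i (tab_insert (i + 2) S)) \<longleftrightarrow> k \<in> A)"
      using two[of "i + 2" i] unfolding w by simp
    then show ?thesis using False up by blast
  qed
qed

text \<open>Decoding at the positions in K maps the tableaux onto all of
  \<open>Pow K\<close>.\<close>

lemma card_EG_tableaux_ge:
  assumes "finite K" "w permutes {1..n}" "\<And>k. k \<in> K \<Longrightarrow> 1 \<le> k \<and> k + 3 \<le> n"
    and "\<And>k l. k \<in> K \<Longrightarrow> l \<in> K \<Longrightarrow> k < l \<Longrightarrow> k + 4 \<le> l"
    and "\<And>k. k \<in> K \<Longrightarrow> has_2143_at w k"
  shows "2 ^ card K \<le> card {S. EG_tableau n w S}"
proof -
  have "Pow K \<subseteq> (\<lambda>S. {k \<in> K. inserted_upwards k S}) ` {S. EG_tableau n w S}"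
  proof
    fix A assume A: "A \<in> Pow K"
    obtain S where S: "EG_tableau n w S" "\<forall>k\<in>K. inserted_upwards k S \<longleftrightarrow> k \<in> A"
      using ex_EG_tableau_inserted_upwards[of K w n A] assms by blast
    then have "A = {k \<in> K. inserted_upwards k S}" using A by auto
    then show "A \<in> (\<lambda>S. {k \<in> K. inserted_upwards k S}) ` {S. EG_tableau n w S}" using S(1) by blast
  qed
  then have "card (Pow K) \<le> card {S. EG_tableau n w S}"
    using finite_EG_tableaux by (meson card_image_le card_mono finite_imageI order_trans)
  then show ?thesis using assms(1) by (simp add: card_Pow)
qed

subsection \<open>From tableaux to fillings\<close>

text \<open>The value 0 past the last row makes the shape of the empty tableau the empty
  partition.\<close>

definition row_lengths :: "nat set list \<Rightarrow> nat \<Rightarrow> nat" where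
  "row_lengths S c = (if c < length S then card (S ! c) else 0)"

text \<open>The fillings of the statement are the transposes of the tableaux considered here: row
  \<open>c\<close> of \<open>S\<close> becomes column \<open>c\<close>.\<close>

definition shape :: "nat set list \<Rightarrow> nat list" where
  "shape S = map (\<lambda>r. card {c. c < length S \<and> r < card (S ! c)}) [0..<row_lengths S 0]"

definition filling :: "nat set list \<Rightarrow> nat \<times> nat \<Rightarrow> nat" where
  "filling S = restrict (\<lambda>(r, c). row_word (S ! c) ! r) (young_diagram (shape S))"

lemma downward_closed_eq_lessThan:
  fixes D :: "nat set"
  assumes "finite D" "\<And>x y. y \<in> D \<Longrightarrow> x \<le> y \<Longrightarrow> x \<in> D"
  shows "D = {..<card D}"
proof (cases "D = {}")
  case False
  have "x \<in> D \<longleftrightarrow> x \<le> Max D" for x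
    using assms(2)[OF Max_in[OF assms(1) False], of x] Max_ge[OF assms(1), of x] by blast
  then have D: "D = {..Max D}" by blast
  have "card D = Suc (Max D)" by (subst D) simp
  then show ?thesis by (subst D) (simp add: lessThan_Suc_atMost)
qed simp

lemma card_upto_nth_sorted_list_of_set:
  fixes R :: "nat set"
  assumes "finite R" "r < card R"
  shows "card {x \<in> R. x \<le> row_word R ! r} = r + 1" "card {x \<in> R. x < row_word R ! r} = r"
proof -
  let ?xs = "row_word R"
  have len: "length ?xs = card R" by simp
  have mono: "?xs ! i < ?xs ! j" if "i < j" "j < card R" for i j
    using sorted_wrt_nth_less[OF strict_sorted_list_of_set, of i j R] that by simp
  have lt: "?xs ! i < ?xs ! j \<longleftrightarrow> i < j" if "i < card R" "j < card R" for i j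
    using mono[of i j] mono[of j i] that by (cases i j rule: linorder_cases) auto
  have inj: "inj_on ((!) ?xs) {..<card R}"
    by (intro inj_on_nth) (simp_all add: len)
  have R: "{x \<in> R. P x} = (!) ?xs ` {i. i < card R \<and> P (?xs ! i)}" for P
  proof -
    have "{x \<in> R. P x} = {x \<in> set ?xs. P x}" using assms by simp
    also have "\<dots> = (!) ?xs ` {i. i < card R \<and> P (?xs ! i)}"
      unfolding len[symmetric] set_conv_nth by blast
    finally show ?thesis .
  qed
  have "{i. i < card R \<and> ?xs ! i < ?xs ! r} = {..<r}"
    using lt assms(2) by auto
  then have "{x \<in> R. x < ?xs ! r} = (!) ?xs ` {..<r}" by (simp add: R)
  moreover have "card ((!) ?xs ` {..<r}) = card {..<r}"
    using assms by (intro card_image inj_on_subset[OF inj]) auto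
  ultimately show "card {x \<in> R. x < ?xs ! r} = r" by simp
  have "?xs ! i \<le> ?xs ! r \<longleftrightarrow> i < r + 1" if "i < card R" for i
    using lt[OF assms(2) that] by (simp add: not_less[symmetric] less_Suc_eq_le)
  then have "{i. i < card R \<and> ?xs ! i \<le> ?xs ! r} = {..<r + 1}"
    using assms(2) by (auto simp: less_Suc_eq_le)
  then have "{x \<in> R. x \<le> ?xs ! r} = (!) ?xs ` {..<r + 1}" by (simp add: R)
  moreover have "card ((!) ?xs ` {..<r + 1}) = card {..<r + 1}"
    using assms by (intro card_image inj_on_subset[OF inj]) auto
  ultimately show "card {x \<in> R. x \<le> ?xs ! r} = r + 1" by simp
qed

text \<open>Back from counts to positions: r + 1 entries of \<open>R'\<close> are at most its entry
  number r (from 0), so at least r + 1 entries of R lie strictly below that value, among them entry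
  number r of R.\<close>

lemma row_below_nth:
  assumes "finite R" "finite R'" "row_below R R'" "r < card R'"
  shows "r < card R" "row_word R ! r < row_word R' ! r"
proof -
  let ?z = "row_word R' ! r"
  have le: "r + 1 \<le> card {x \<in> R. x < ?z}"
    unfolding card_upto_nth_sorted_list_of_set(1)[OF assms(2,4), symmetric]
    using assms(3) by (simp add: row_below_def)
  also have "\<dots> \<le> card R" using assms(1) by (intro card_mono) auto
  finally show r: "r < card R" by simp
  show "row_word R ! r < ?z"
  proof (rule ccontr)
    assume "\<not> row_word R ! r < ?z"
    then have "card {x \<in> R. x < ?z} \<le> card {x \<in> R. x < row_word R ! r}"
      using assms(1) by (intro card_mono) auto
    then show False using le card_upto_nth_sorted_list_of_set(2)[OF assms(1) r] by simp
  qed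
qed

context
  fixes S :: "nat set list"
  assumes S: "tableau S"
begin

lemma row_finite: "c < length S \<Longrightarrow> finite (S ! c)" and row_nonempty: "c < length S \<Longrightarrow> 0 < card (S ! c)"
  using S by (auto simp: tableau_def card_gt_0_iff)

lemma row_below_nth_nth: "c < c' \<Longrightarrow> c' < length S \<Longrightarrow> row_below (S ! c) (S ! c')"
  using S by (simp add: tableau_def sorted_wrt_nth_less)

lemma column_initial:
  "{c. c < length S \<and> r < card (S ! c)} = {..<card {c. c < length S \<and> r < card (S ! c)}}"
proof (rule downward_closed_eq_lessThan)
  fix c' c assume "c' \<in> {c. c < length S \<and> r < card (S ! c)}" "c \<le> c'"
  then show "c \<in> {c. c < length S \<and> r < card (S ! c)}"
    using row_below_nth(1)[OF row_finite row_finite row_below_nth_nth, of c c' r]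
    by (cases "c = c'") auto
qed simp

lemma length_shape: "length (shape S) = row_lengths S 0"
  by (simp add: shape_def)

lemma less_shape_nth:
  assumes "r < length (shape S)"
  shows "c < shape S ! r \<longleftrightarrow> c < length S \<and> r < card (S ! c)"
proof -
  have "c < shape S ! r \<longleftrightarrow> c \<in> {..<card {c. c < length S \<and> r < card (S ! c)}}"
    using assms by (simp add: shape_def)
  then show ?thesis unfolding column_initial[symmetric] by simp
qed

lemma mem_young_diagram_shape:
  "(r, c) \<in> young_diagram (shape S) \<longleftrightarrow> c < length S \<and> r < card (S ! c)"
proof -
  \<comment> \<open>The top row is the longest, so cutting the shape off at its length loses no
    cell.\<close>
  have "r < row_lengths S 0" if "c < length S" "r < card (S ! c)"
    using that row_below_nth(1)[OF row_finite row_finite row_below_nth_nth, of 0 c r]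
    by (cases "c = 0") (auto simp: row_lengths_def)
  then show ?thesis
    using less_shape_nth[of r c] by (auto simp: young_diagram_def length_shape)
qed

lemma is_partition_shape: "is_partition (shape S)"
proof -
  have "shape S ! r' \<le> shape S ! r" if "r < r'" "r' < length (shape S)" for r r'
    using that unfolding shape_def by (auto intro!: card_mono)
  moreover have "0 < shape S ! r" if "r < length (shape S)" for r
    using that less_shape_nth[of r 0] by (auto simp: length_shape row_lengths_def split: if_splits)
  ultimately show ?thesis
    by (auto simp: is_partition_def sorted_wrt_iff_nth_less in_set_conv_nth)
qed

text \<open>The first part of the transposed shape counts the nonempty rows of S, and all of them
  are nonempty.\<close>

lemma num_columns_shape: "num_columns (shape S) = length S"
proof (cases S)
  case (Cons R S')
  have pos: "0 < length (shape S)"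
    unfolding length_shape row_lengths_def using row_nonempty[of 0] Cons by simp
  have "c < shape S ! 0 \<longleftrightarrow> c < length S" for c
    using less_shape_nth[OF pos, of c] row_nonempty by blast
  then have "shape S ! 0 = length S" by (metis linorder_neqE_nat less_irrefl)
  then show ?thesis using pos by (cases "shape S") (auto simp: num_columns_def)
qed (simp add: shape_def row_lengths_def num_columns_def)

lemma map_filling_column:
  assumes "c < length S"
  shows "map (filling S) (column_cells (shape S) c) = row_word (S ! c)"
proof -
  have "filter (\<lambda>r. c < shape S ! r) [0..<length (shape S)] =
      filter (\<lambda>r. r < card (S ! c)) [0..<length (shape S)]"
  proof (rule filter_cong)
    fix r assume "r \<in> set [0..<length (shape S)]"
    then show "c < shape S ! r \<longleftrightarrow> r < card (S ! c)"
      using less_shape_nth[of r c] assms by simp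
  qed simp
  also have "\<dots> = [0..<card (S ! c)]"
  proof (rule sorted_distinct_set_unique)
    have "r < length (shape S)" if "r < card (S ! c)" for r
      using mem_young_diagram_shape[of r c] that assms by (simp add: young_diagram_def)
    then show "set (filter (\<lambda>r. r < card (S ! c)) [0..<length (shape S)]) = set [0..<card (S ! c)]"
      by auto
  qed (simp_all add: sorted_wrt_filter)
  finally have "map (filling S) (column_cells (shape S) c) =
      map (\<lambda>r. filling S (r, c)) [0..<card (S ! c)]"
    by (simp add: column_cells_def)
  also have "\<dots> = map ((!) (row_word (S ! c))) [0..<length (row_word (S ! c))]"
  proof (rule map_cong)
    fix r assume "r \<in> set [0..<length (row_word (S ! c))]"
    then show "filling S (r, c) = row_word (S ! c) ! r"
      using mem_young_diagram_shape[of r c] assms by (simp add: filling_def)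
  qed simp
  finally show ?thesis by (simp only: map_nth)
qed

text \<open>Columns taken from right to left are the rows of S taken from the bottom up, the order
  built into \<open>rows_word\<close>.\<close>

lemma reading_word_filling: "reading_word (shape S) (filling S) = rows_word S"
proof -
  have "reading_word (shape S) (filling S) =
      concat (map (\<lambda>c. map (filling S) (column_cells (shape S) c)) (rev [0..<length S]))"
    by (simp add: reading_word_def reading_order_def num_columns_shape map_concat comp_def)
  also have "\<dots> = concat (map (\<lambda>c. row_word (S ! c)) (rev [0..<length S]))"
    using map_filling_column by (intro arg_cong[of _ _ concat] map_cong) auto
  also have "map (\<lambda>c. row_word (S ! c)) (rev [0..<length S]) = map row_word (rev (map ((!) S) [0..<length S]))"
    by (simp add: rev_map comp_def)
  finally show ?thesis unfolding rows_word_def map_nth .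
qed

lemma increasing_filling_filling:
  assumes "\<forall>x\<in>\<Union> (set S). 0 < x"
  shows "increasing_filling (shape S) (filling S)"
proof -
  have val: "filling S (r, c) = row_word (S ! c) ! r" if "(r, c) \<in> young_diagram (shape S)" for r c
    using that by (simp add: filling_def)
  show ?thesis unfolding increasing_filling_def
  proof (intro conjI allI impI ballI)
    fix x assume x: "x \<in> young_diagram (shape S)"
    obtain r c where rc: "x = (r, c)" by fastforce
    then have "c < length S" "r < card (S ! c)" using x mem_young_diagram_shape by auto
    then have "row_word (S ! c) ! r \<in> S ! c"
      using nth_mem[of r "row_word (S ! c)"] row_finite by simp
    then show "0 < filling S x" using assms \<open>c < length S\<close> x rc val by auto
  next
    fix r c c'
    assume A: "(r, c) \<in> young_diagram (shape S) \<and> (r, c') \<in> young_diagram (shape S) \<and> c < c'"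
    then show "filling S (r, c) < filling S (r, c')"
      using row_below_nth(2)[OF row_finite row_finite row_below_nth_nth, of c c' r]
      by (auto simp: val mem_young_diagram_shape)
  next
    fix r r' c
    assume A: "(r, c) \<in> young_diagram (shape S) \<and> (r', c) \<in> young_diagram (shape S) \<and> r < r'"
    then show "filling S (r, c) < filling S (r', c)"
      using sorted_wrt_nth_less[OF strict_sorted_list_of_set, of r r' "S ! c"]
      by (auto simp: val mem_young_diagram_shape)
  qed (simp add: filling_def)
qed

lemma row_eq_filling_image:
  assumes "c < length S"
  shows "S ! c = (\<lambda>r. filling S (r, c)) ` {r. (r, c) \<in> young_diagram (shape S)}"
proof -
  have "S ! c = set (row_word (S ! c))" using row_finite[OF assms] by simp
  also have "\<dots> = filling S ` set (column_cells (shape S) c)"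
    unfolding map_filling_column[OF assms, symmetric] by simp
  also have "set (column_cells (shape S) c) = (\<lambda>r. (r, c)) ` {r. (r, c) \<in> young_diagram (shape S)}"
    by (auto simp: column_cells_def young_diagram_def)
  finally show ?thesis by (simp add: image_image)
qed

end

text \<open>The shape determines the number of rows of S, and each row is recovered as the set of
  values in a column of the filling.\<close>

lemma inj_on_shape_filling: "inj_on (\<lambda>S. (shape S, filling S)) {S. tableau S}"
proof (rule inj_onI)
  fix S S' assume S: "S \<in> {S. tableau S}" "S' \<in> {S. tableau S}"
    and eq: "(shape S, filling S) = (shape S', filling S')"
  show "S = S'"
  proof (rule nth_equalityI)
    show "length S = length S'"
      using S eq num_columns_shape by (metis mem_Collect_eq prod.inject)
    then show "S ! c = S' ! c" if "c < length S" for c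
      using S eq that row_eq_filling_image[of S c] row_eq_filling_image[of S' c] by simp
  qed
qed

text \<open>The statistic is the cardinality of a disjoint union over shapes, hence the map that
  records the shape along with the filling.\<close>

lemma card_EG_tableaux_le: "card {S. EG_tableau n w S} \<le> EG n w"
proof -
  let ?P = "{lam. is_partition lam \<and> sum_list lam = num_inversions n w}"
  have "(\<lambda>S. (shape S, filling S)) ` {S. EG_tableau n w S} \<subseteq> (SIGMA lam:?P. EG_fillings n w lam)"
  proof (intro image_subsetI SigmaI CollectI conjI)
    fix S assume "S \<in> {S. EG_tableau n w S}"
    then have S: "tableau S" and red: "reduced_word n w (reading_word (shape S) (filling S))"
      by (auto simp: EG_tableau_def reading_word_filling)
    show "is_partition (shape S)" using S by (rule is_partition_shape)
    then show "sum_list (shape S) = num_inversions n w"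
      using red length_reading_word by (metis reduced_word_def)
    have fin: "\<forall>R\<in>set S. finite R" using S by (simp add: tableau_def)
    have "\<forall>x\<in>\<Union> (set S). 0 < x"
      using red unfolding reading_word_filling[OF S] reduced_word_def set_rows_word[OF fin] by (auto simp: Suc_le_eq)
    then show "filling S \<in> EG_fillings n w (shape S)"
      using red increasing_filling_filling[OF S] by (simp add: EG_fillings_def)
  qed
  then have "card ((\<lambda>S. (shape S, filling S)) ` {S. EG_tableau n w S}) \<le> card (SIGMA lam:?P. EG_fillings n w lam)"
    using finite_partitions finite_EG_fillings by (intro card_mono finite_SigmaI) auto
  also have "\<dots> = EG n w"
    unfolding EG_def EG_coeff_def using finite_partitions finite_EG_fillings by (intro card_SigmaI) auto
  also have "card ((\<lambda>S. (shape S, filling S)) ` {S. EG_tableau n w S}) = card {S. EG_tableau n w S}"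
    using inj_on_shape_filling by (intro card_image) (auto simp: EG_tableau_def inj_on_def)
  finally show ?thesis .
qed

subsection \<open>Occurrences of 2143 in a random permutation\<close>

text \<open>In this form the values on the block are determined by their set, which no rearrangement
  of the block changes; uniqueness in \<open>permutes_2143_unique\<close> follows.\<close>

lemma has_2143_at_iff:
  "has_2143_at u i \<longleftrightarrow>
    [u (i + 1), u i, u (i + 3), u (i + 2)] = sorted_list_of_set (u ` {i, i + 1, i + 2, i + 3})"
    (is "_ \<longleftrightarrow> ?xs = sorted_list_of_set ?B")
proof
  assume "has_2143_at u i"
  then show "?xs = sorted_list_of_set ?B"
    by (intro sorted_distinct_set_unique) (auto simp: has_2143_at_def)
next
  assume "?xs = sorted_list_of_set ?B"
  then have "sorted_wrt (<) ?xs" using strict_sorted_list_of_set by metis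
  then show "has_2143_at u i" by (simp add: has_2143_at_def)
qed

lemma ex_permutes_2143:
  assumes "inj (v :: nat \<Rightarrow> nat)"
  shows "\<exists>\<sigma>. \<sigma> permutes {i, i + 1, i + 2, i + 3} \<and> has_2143_at (v \<circ> \<sigma>) i"
proof -
  let ?B = "{i, i + 1, i + 2, i + 3}"
  let ?xs = "sorted_list_of_set (v ` ?B)"
  have "card (v ` ?B) = card ?B" by (rule card_image[OF inj_on_subset[OF assms subset_UNIV]])
  also have "card ?B = 4" by simp
  finally have "card (v ` ?B) = 4" .
  then have "length ?xs = 4" by (simp only: length_sorted_list_of_set)
  moreover have "\<exists>a b c d. ys = [a, b, c, d]" if "length ys = 4" for ys :: "nat list"
    using that by (auto simp: numeral_eq_Suc length_Suc_conv)
  ultimately obtain a b c d where xs: "?xs = [a, b, c, d]" by blast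
  have set: "v ` ?B = {a, b, c, d}"
    using set_sorted_list_of_set[of "v ` ?B"] unfolding xs by simp
  have lt: "a < b" "b < c" "c < d"
    using strict_sorted_list_of_set[of "v ` ?B"] unfolding xs by auto
  have ex: "\<exists>p. p \<in> ?B \<and> v p = y" if "y \<in> {a, b, c, d}" for y
    using that unfolding set[symmetric] by (elim imageE) blast
  obtain p where p: "p \<in> ?B" "v p = a" using ex[of a] by blast
  obtain q where q: "q \<in> ?B" "v q = b" using ex[of b] by blast
  obtain r where r: "r \<in> ?B" "v r = c" using ex[of c] by blast
  obtain s where s: "s \<in> ?B" "v s = d" using ex[of d] by blast
  \<comment> \<open>The pattern lists the block in the order i + 1, i, i + 3, i + 2 of increasing
    values; these are sent to the positions p, q, r, s of the four values of v in increasing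
    order.\<close>
  define \<sigma> where "\<sigma> = id(i + 1 := p, i := q, i + 3 := r, i + 2 := s)"
  have \<sigma>: "\<sigma> (i + 1) = p" "\<sigma> i = q" "\<sigma> (i + 3) = r" "\<sigma> (i + 2) = s"
    by (simp_all add: \<sigma>_def)
  have v\<sigma>: "v (\<sigma> (i + 1)) = a" "v (\<sigma> i) = b" "v (\<sigma> (i + 3)) = c" "v (\<sigma> (i + 2)) = d"
    unfolding \<sigma> by (rule p(2) q(2) r(2) s(2))+
  have "x = y" if "x \<in> ?B" "y \<in> ?B" "v (\<sigma> x) = v (\<sigma> y)" for x y
    using that v\<sigma> lt by (elim insertE emptyE; simp)
  then have "inj_on \<sigma> ?B" by (simp only: inj_on_def) metis
  moreover have "\<sigma> ` ?B \<subseteq> ?B"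
    unfolding image_insert image_empty \<sigma> insert_subset
    by (intro conjI p(1) q(1) r(1) s(1) empty_subsetI)
  ultimately have "bij_betw \<sigma> ?B ?B"
    by (metis bij_betw_def endo_inj_surj finite.emptyI finite_insert)
  moreover have "\<sigma> x = x" if "x \<notin> ?B" for x
    using that by (simp add: \<sigma>_def)
  ultimately have "\<sigma> permutes ?B" by (rule bij_imp_permutes)
  moreover have "has_2143_at (v \<circ> \<sigma>) i"
    using lt v\<sigma> by (simp add: has_2143_at_def)
  ultimately show ?thesis by blast
qed

lemma permutes_2143_unique:
  assumes "inj (v :: nat \<Rightarrow> nat)"
    and "\<sigma> permutes {i, i + 1, i + 2, i + 3}" "has_2143_at (v \<circ> \<sigma>) i"
    and "\<tau> permutes {i, i + 1, i + 2, i + 3}" "has_2143_at (v \<circ> \<tau>) i"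
  shows "\<sigma> = \<tau>"
proof
  fix x
  let ?B = "{i, i + 1, i + 2, i + 3}"
  have "(v \<circ> \<sigma>) ` ?B = v ` ?B" "(v \<circ> \<tau>) ` ?B = v ` ?B"
    unfolding image_comp[symmetric] permutes_image[OF assms(2)] permutes_image[OF assms(4)] by simp_all
  then have "[v (\<sigma> (i + 1)), v (\<sigma> i), v (\<sigma> (i + 3)), v (\<sigma> (i + 2))] =
      [v (\<tau> (i + 1)), v (\<tau> i), v (\<tau> (i + 3)), v (\<tau> (i + 2))]"
    using assms(3,5) unfolding has_2143_at_iff by simp
  then show "\<sigma> x = \<tau> x"
    using injD[OF assms(1)] permutes_not_in[OF assms(2), of x] permutes_not_in[OF assms(4), of x]
    by (cases "x \<in> ?B") auto
qed

text \<open>Each class of Q under rearranging the four positions has 4! = 24 members, exactly one of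
  which carries the pattern. Q is kept general so that the count can be repeated inside the set of
  permutations with the pattern at another block.\<close>

lemma card_has_2143_at:
  assumes "finite Q" "\<And>w. w \<in> Q \<Longrightarrow> inj w"
    and "\<And>w \<sigma>. w \<in> Q \<Longrightarrow> \<sigma> permutes {i, i + 1, i + 2, i + 3} \<Longrightarrow> w \<circ> \<sigma> \<in> Q"
  shows "card Q = 24 * card {w \<in> Q. has_2143_at w i}"
proof -
  let ?B = "{i, i + 1, i + 2, i + 3}"
  let ?P = "{\<sigma>. \<sigma> permutes ?B}" and ?G = "{w \<in> Q. has_2143_at w i}"
  have cancel: "w \<circ> inv \<sigma> \<circ> \<sigma> = w" "w \<circ> \<sigma> \<circ> inv \<sigma> = w" if "\<sigma> permutes ?B" for w :: "nat \<Rightarrow> nat" and \<sigma>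
    by (simp_all only: comp_assoc permutes_inv_o[OF that] comp_id)
  have "bij_betw (\<lambda>(\<sigma>, w). w \<circ> inv \<sigma>) (?P \<times> ?G) Q"
  proof (rule bij_betwI')
    fix p p' assume A: "p \<in> ?P \<times> ?G" "p' \<in> ?P \<times> ?G"
    show "(case p of (\<sigma>, w) \<Rightarrow> w \<circ> inv \<sigma>) = (case p' of (\<sigma>, w) \<Rightarrow> w \<circ> inv \<sigma>) \<longleftrightarrow> p = p'"
    proof
      assume eq: "(case p of (\<sigma>, w) \<Rightarrow> w \<circ> inv \<sigma>) = (case p' of (\<sigma>, w) \<Rightarrow> w \<circ> inv \<sigma>)"
      obtain \<sigma> w \<tau> u where p: "p = (\<sigma>, w)" "p' = (\<tau>, u)" by (cases p; cases p')
      define v where "v = w \<circ> inv \<sigma>"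
      have perms: "\<sigma> permutes ?B" "\<tau> permutes ?B" and wu: "w \<in> ?G" "u \<in> ?G" using A p by auto
      have v: "v = u \<circ> inv \<tau>" using eq by (simp add: p v_def)
      have "v \<in> Q" using wu(1) assms(3)[OF _ permutes_inv[OF perms(1)]] by (simp add: v_def)
      have vw: "v \<circ> \<sigma> = w" unfolding v_def by (rule cancel(1)[OF perms(1)])
      have vu: "v \<circ> \<tau> = u" unfolding v by (rule cancel(1)[OF perms(2)])
      have "\<sigma> = \<tau>"
        using permutes_2143_unique[OF assms(2)[OF \<open>v \<in> Q\<close>] perms(1) _ perms(2)] wu by (simp add: vw vu)
      then show "p = p'" using vw vu p by simp
    qed simp
  next
    fix p assume "p \<in> ?P \<times> ?G"
    then show "(case p of (\<sigma>, w) \<Rightarrow> w \<circ> inv \<sigma>) \<in> Q"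
      using assms(3) permutes_inv by auto
  next
    fix v assume v: "v \<in> Q"
    obtain \<sigma> where \<sigma>: "\<sigma> permutes ?B" "has_2143_at (v \<circ> \<sigma>) i"
      using ex_permutes_2143[OF assms(2)[OF v]] by blast
    then have "(\<sigma>, v \<circ> \<sigma>) \<in> ?P \<times> ?G" using assms(3)[OF v] by simp
    moreover have "v = (case (\<sigma>, v \<circ> \<sigma>) of (\<sigma>, w) \<Rightarrow> w \<circ> inv \<sigma>)" using cancel(2)[OF \<sigma>(1)] by simp
    ultimately show "\<exists>p\<in>?P \<times> ?G. v = (case p of (\<sigma>, w) \<Rightarrow> w \<circ> inv \<sigma>)" by blast
  qed
  then have "card Q = card (?P \<times> ?G)" by (rule bij_betw_same_card[symmetric])
  also have "\<dots> = card ?P * card ?G" by (rule card_cartesian_product)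
  also have "card ?P = fact 4" by (rule card_permutations) auto
  finally show ?thesis by (simp add: fact_numeral)
qed

definition num_2143_blocks :: "nat \<Rightarrow> (nat \<Rightarrow> nat) \<Rightarrow> nat" where
  "num_2143_blocks n w = card {k. k < n div 4 \<and> has_2143_at w (4 * k + 1)}"

lemma EG_ge_num_2143_blocks:
  assumes "w permutes {1..n}"
  shows "2 ^ num_2143_blocks n w \<le> EG n w"
proof -
  let ?K = "(\<lambda>k. 4 * k + 1) ` {k. k < n div 4 \<and> has_2143_at w (4 * k + 1)}"
  have "2 ^ card ?K \<le> card {S. EG_tableau n w S}"
    using assms by (intro card_EG_tableaux_ge) auto
  also have "card ?K = num_2143_blocks n w"
    unfolding num_2143_blocks_def by (intro card_image) (auto simp: inj_on_def)
  finally show ?thesis using card_EG_tableaux_le[of n w] by linarith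
qed

section \<open>Second moment and concentration\<close>

context
  fixes n :: nat
begin

abbreviation (input) "perms \<equiv> {w. w permutes {1..n}}"

lemma finite_perms: "finite perms"
  by (rule finite_permutations) simp

lemma perms_comp_block:
  assumes "w \<in> perms" "k < n div 4" "\<sigma> permutes {4 * k + 1, 4 * k + 1 + 1, 4 * k + 1 + 2, 4 * k + 1 + 3}"
  shows "w \<circ> \<sigma> \<in> perms"
proof -
  have "\<sigma> permutes {1..n}" using assms(2) by (intro permutes_subset[OF assms(3)]) auto
  then show ?thesis using assms(1) by (simp add: permutes_compose)
qed

lemma card_one_block:
  assumes "k < n div 4"
  shows "real (card perms) = 24 * real (card {w \<in> perms. has_2143_at w (4 * k + 1)})"
proof -
  have "card perms = 24 * card {w \<in> perms. has_2143_at w (4 * k + 1)}"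
  proof (rule card_has_2143_at)
    show "inj w" if "w \<in> perms" for w using that permutes_inj by blast
    show "w \<circ> \<sigma> \<in> perms"
      if "w \<in> perms" "\<sigma> permutes {4 * k + 1, 4 * k + 1 + 1, 4 * k + 1 + 2, 4 * k + 1 + 3}" for w \<sigma>
      using perms_comp_block[OF that(1) assms that(2)] .
  qed (rule finite_perms)
  then show ?thesis by simp
qed

text \<open>Pairwise independence, 576 = 24^2: rearranging block l does not affect the pattern at
  block k, so the one-block count applies within the permutations with the pattern at k.\<close>

lemma card_two_blocks:
  assumes "k < n div 4" "l < n div 4" "k \<noteq> l"
  shows "real (card perms) =
    576 * real (card {w \<in> perms. has_2143_at w (4 * k + 1) \<and> has_2143_at w (4 * l + 1)})"
proof -
  let ?Q = "{w \<in> perms. has_2143_at w (4 * k + 1)}"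
  have "card ?Q = 24 * card {w \<in> ?Q. has_2143_at w (4 * l + 1)}"
  proof (rule card_has_2143_at)
    show "finite ?Q" using finite_perms by simp
    show "inj w" if "w \<in> ?Q" for w using that permutes_inj by blast
    show "w \<circ> \<sigma> \<in> ?Q"
      if "w \<in> ?Q" and \<sigma>: "\<sigma> permutes {4 * l + 1, 4 * l + 1 + 1, 4 * l + 1 + 2, 4 * l + 1 + 3}" for w \<sigma>
    proof -
      have "\<sigma> (4 * k + 1 + j) = 4 * k + 1 + j" if "j < 4" for j
      proof -
        have "4 * k + 1 + j < 4 * l + 1 \<or> 4 * l + 1 + 3 < 4 * k + 1 + j"
          using that assms(3) by linarith
        then show ?thesis by (intro permutes_not_in[OF \<sigma>]) auto
      qed
      from this[of 0] this[of 1] this[of 2] this[of 3]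
      have "has_2143_at (w \<circ> \<sigma>) (4 * k + 1)"
        using \<open>w \<in> ?Q\<close> by (simp add: has_2143_at_def)
      then show ?thesis using perms_comp_block[OF _ assms(2) \<sigma>] \<open>w \<in> ?Q\<close> by simp
    qed
  qed
  moreover have "{w \<in> ?Q. has_2143_at w (4 * l + 1)} =
      {w \<in> perms. has_2143_at w (4 * k + 1) \<and> has_2143_at w (4 * l + 1)}" by blast
  ultimately show ?thesis using card_one_block[OF assms(1)] by simp
qed

text \<open>Covariances of the indicators, multiplied by the number of permutations. On the diagonal
  stands the Bernoulli variance (1/24)(1 - 1/24) = 23/576.\<close>

lemma sum_centred_product:
  assumes "k < n div 4" "l < n div 4"
  shows "(\<Sum>w\<in>perms. (of_bool (has_2143_at w (4 * k + 1)) - 1 / 24) *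
      (of_bool (has_2143_at w (4 * l + 1)) - 1 / 24 :: real)) =
    (if k = l then real (card perms) * (23 / 576) else 0)" (is "?L = _")
proof -
  let ?X = "\<lambda>k w. of_bool (has_2143_at w (4 * k + 1)) :: real"
  have one: "(\<Sum>w\<in>perms. ?X j w) = real (card perms) / 24" if "j < n div 4" for j
    using card_one_block[OF that] finite_perms by (simp add: Int_def)
  have two: "(\<Sum>w\<in>perms. ?X k w * ?X l w) = (if k = l then real (card perms) / 24 else real (card perms) / 576)"
  proof (cases "k = l")
    case True
    then show ?thesis using one[OF assms(1)] by (simp flip: of_bool_conj)
  next
    case False
    then show ?thesis using card_two_blocks[OF assms] finite_perms
      by (simp add: Int_def flip: of_bool_conj)
  qed
  have "?L = (\<Sum>w\<in>perms. ?X k w * ?X l w - (1 / 24) * ?X k w - (1 / 24) * ?X l w + 1 / 576)"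
    by (intro sum.cong) (simp_all add: algebra_simps)
  also have "\<dots> = (\<Sum>w\<in>perms. ?X k w * ?X l w) - (1 / 24) * (\<Sum>w\<in>perms. ?X k w)
      - (1 / 24) * (\<Sum>w\<in>perms. ?X l w) + real (card perms) * (1 / 576)"
    by (simp only: sum.distrib sum_subtractf sum_distrib_left sum_constant)
  also have "\<dots> = (if k = l then real (card perms) * (23 / 576) else 0)"
    unfolding two one[OF assms(1)] one[OF assms(2)] by simp
  finally show ?thesis .
qed

lemma sum_variance:
  "(\<Sum>w\<in>perms. (real (num_2143_blocks n w) - real (n div 4) / 24)\<^sup>2) =
    real (n div 4) * (real (card perms) * (23 / 576))"
proof -
  let ?m = "n div 4"
  let ?Y = "\<lambda>k w. of_bool (has_2143_at w (4 * k + 1)) - 1 / 24 :: real"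
  have eq: "real (num_2143_blocks n w) - real ?m / 24 = (\<Sum>k<?m. ?Y k w)" for w
    by (simp add: num_2143_blocks_def sum_subtractf Int_def lessThan_def)
  have "(\<Sum>w\<in>perms. (real (num_2143_blocks n w) - real ?m / 24)\<^sup>2) =
      (\<Sum>w\<in>perms. \<Sum>k<?m. \<Sum>l<?m. ?Y k w * ?Y l w)"
    by (simp only: eq power2_eq_square sum_product)
  also have "\<dots> = (\<Sum>k<?m. \<Sum>w\<in>perms. \<Sum>l<?m. ?Y k w * ?Y l w)"
    by (rule sum.swap)
  also have "\<dots> = (\<Sum>k<?m. \<Sum>l<?m. \<Sum>w\<in>perms. ?Y k w * ?Y l w)"
    by (intro sum.cong refl sum.swap)
  also have "\<dots> = (\<Sum>k<?m. \<Sum>l<?m. if k = l then real (card perms) * (23 / 576) else 0)"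
    using sum_centred_product by (intro sum.cong refl) auto
  also have "\<dots> = real ?m * (real (card perms) * (23 / 576))"
    by simp
  finally show ?thesis .
qed

text \<open>Chebyshev's inequality by counting: with m = n div 4, falling below half of the mean
  m/24 is a deviation of more than m/48. Clearing denominators lets the bound include m = 0.\<close>

lemma card_few_blocks:
  "real (card {w \<in> perms. real (num_2143_blocks n w) < real (n div 4) / 48}) * real (n div 4)
    \<le> 96 * real (card perms)" (is "real (card ?F) * real ?m \<le> _")
proof (cases "?m = 0")
  case False
  have "real (card ?F) * (real ?m / 48)\<^sup>2 = (\<Sum>w\<in>?F. (real ?m / 48)\<^sup>2)" by simp
  also have "\<dots> \<le> (\<Sum>w\<in>?F. (real (num_2143_blocks n w) - real ?m / 24)\<^sup>2)"
  proof (rule sum_mono)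
    fix w assume "w \<in> ?F"
    then have "real ?m / 48 \<le> real ?m / 24 - real (num_2143_blocks n w)" by simp
    then have "(real ?m / 48)\<^sup>2 \<le> (real ?m / 24 - real (num_2143_blocks n w))\<^sup>2"
      by (intro power_mono) auto
    then show "(real ?m / 48)\<^sup>2 \<le> (real (num_2143_blocks n w) - real ?m / 24)\<^sup>2"
      by (simp add: power2_commute)
  qed
  also have "\<dots> \<le> (\<Sum>w\<in>perms. (real (num_2143_blocks n w) - real ?m / 24)\<^sup>2)"
    using finite_perms by (intro sum_mono2) auto
  also have "\<dots> = real ?m * (real (card perms) * (23 / 576))" by (rule sum_variance)
  \<comment> \<open>Rounding 23 up to 24 turns the factor 48^2 * 23 / 576 = 92 into 96.\<close>
  also have "\<dots> \<le> real ?m * (real (card perms) * (24 / 576))"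
    by (intro mult_left_mono) auto
  finally have "real ?m * (real (card ?F) * real ?m) \<le> real ?m * (96 * real (card perms))"
    by (simp add: power2_eq_square field_simps)
  then show ?thesis using False by simp
qed simp

text \<open>From n div 4 >= n / 8, the threshold (n div 4) / 48 is at least n / 384, and the failure
  bound 96 / (n div 4) is at most 768 / n.\<close>

lemma prob_EG_ge:
  assumes "8 \<le> n"
  shows "measure_pmf.prob (pmf_of_set perms) {w. real (EG n w) \<ge> 2 powr (1 / 384 * real n)}
    \<ge> 1 - 768 / real n"
proof -
  let ?m = "n div 4" and ?E = "{w. real (EG n w) \<ge> 2 powr (1 / 384 * real n)}"
  let ?F = "{w \<in> perms. real (num_2143_blocks n w) < real ?m / 48}"
  have m: "real n / 8 \<le> real ?m"
    using assms by linarith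
  have perms: "perms \<noteq> {}" using permutes_id by blast
  then have pos: "0 < real (card perms)" using finite_perms by (simp add: card_gt_0_iff)
  have "perms - ?F \<subseteq> perms \<inter> ?E"
  proof
    fix w assume w: "w \<in> perms - ?F"
    then have "1 / 384 * real n \<le> real (num_2143_blocks n w)" using m by auto
    then have "2 powr (1 / 384 * real n) \<le> 2 powr real (num_2143_blocks n w)" by simp
    also have "\<dots> = real (2 ^ num_2143_blocks n w)" by (simp add: powr_realpow)
    also have "\<dots> \<le> real (EG n w)" using EG_ge_num_2143_blocks w by (simp only: of_nat_le_iff) simp
    finally show "w \<in> perms \<inter> ?E" using w by simp
  qed
  then have "card (perms - ?F) \<le> card (perms \<inter> ?E)" using finite_perms by (intro card_mono) auto
  moreover have "card (perms - ?F) = card perms - card ?F"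
    using finite_perms by (intro card_Diff_subset) auto
  moreover have "card ?F \<le> card perms" using finite_perms by (intro card_mono) auto
  ultimately have E: "real (card perms) - real (card ?F) \<le> real (card (perms \<inter> ?E))" by linarith
  have "real (card ?F) * (real n / 8) \<le> real (card ?F) * real ?m"
    using m by (intro mult_left_mono) auto
  also have "\<dots> \<le> 96 * real (card perms)" by (rule card_few_blocks)
  finally have "real (card ?F) \<le> 768 / real n * real (card perms)"
    using assms by (simp add: field_simps)
  then have "(1 - 768 / real n) * real (card perms) \<le> real (card (perms \<inter> ?E))"
    using E by (simp add: algebra_simps)
  then have "1 - 768 / real n \<le> real (card (perms \<inter> ?E)) / real (card perms)"
    using pos by (simp add: pos_le_divide_eq)
  then show ?thesis
    using perms finite_perms by (simp add: measure_pmf_of_set)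
qed

end

theorem theorem3p2:
  fixes \<gamma> :: real
  assumes "0 < \<gamma>" and "\<gamma> < 1 / 2"
  shows "\<exists>\<alpha>::real. \<alpha> > 0 \<and>
    (\<forall>\<^sub>F n :: nat in sequentially.
      measure_pmf.prob (pmf_of_set {w :: nat \<Rightarrow> nat. w permutes {1..n}})
        {w. real (EG n w) \<ge> 2 powr (\<alpha> * real n)}
      \<ge> 1 - 1 / real n powr (2 * \<gamma>))"
proof (intro exI[of _ "1 / 384"] conjI)
  \<comment> \<open>As 2\<gamma> < 1, this power eventually exceeds 768, so that 768 / n drops below
    the allowed failure probability.\<close>
  have "filterlim (\<lambda>n. real n powr (1 - 2 * \<gamma>)) at_top sequentially"
    using assms(2) by (intro filterlim_compose[OF real_powr_at_top filterlim_real_sequentially]) simp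
  then have "\<forall>\<^sub>F n in sequentially. 768 \<le> real n powr (1 - 2 * \<gamma>)"
    by (simp add: filterlim_at_top)
  then show "\<forall>\<^sub>F n in sequentially.
      measure_pmf.prob (pmf_of_set {w. w permutes {1..n}}) {w. real (EG n w) \<ge> 2 powr (1 / 384 * real n)}
      \<ge> 1 - 1 / real n powr (2 * \<gamma>)"
    using eventually_ge_at_top[of 8]
  proof eventually_elim
    case (elim n)
    have "768 * real n powr (2 * \<gamma>) \<le> real n powr (1 - 2 * \<gamma>) * real n powr (2 * \<gamma>)"
      using elim(1) by (intro mult_right_mono) auto
    also have "\<dots> = real n"
      using elim(2) by (simp flip: powr_add)
    finally have "768 / real n \<le> 1 / real n powr (2 * \<gamma>)"
      using elim(2) by (simp add: field_simps)
    then show ?case using prob_EG_ge[OF elim(2)] by linarith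
  qed
qed simp

end
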